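(* Let $k\ge2$, $N\ge3$ be integers, let $s_1,\ldots,s_k\in\mathbb{R}^2$ be fixed (known) unit vectors, no two of them parallel, and let $$A=A(k,N)=\bigcup_{r=1}^{N}\Big[\,2\Big\lfloor\frac{2N}{r}\Big\rfloor(k-1)\Big]_0\times[2r(k-1)]_0\subseteq\mathbb{Z}^2 .$$ Consider the class of all polygonal regions $P\subseteq[0,1)^2$, with vertices in $[0,1)^2$, having at most $N$ vertices and such that every edge of $P$ is parallel to one of $s_1,\ldots,s_k$. Then every $P$ in this class is determined, within the class, by the values of $\widehat{\mathbb{1}_P}$ on $A$: if $P,Q$ belong to the class and $\widehat{\mathbb{1}_P}(a)=\widehat{\mathbb{1}_Q}(a)$ for all $a\in A$, then $P=Q$. Moreover $|A|=O(k^2N\log N)$ with an absolute implied constant.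
   Context: For an integer $m\ge0$, $[m]_0=\{0,1,\ldots,m\}$. A polygonal region is given by an ordered sequence of vertices $v_0,\ldots,v_{n-1}\in\mathbb{R}^2$ ($n\ge 3$) which, joined cyclically by line segments (edges) $v_jv_{j+1}$ (indices mod $n$) that do not intersect except at the vertices, form a simple closed polygonal curve; successive edges are not parallel. The polygonal region is the interior (the bounded open region enclosed) of this curve. $\mathbb{1}_P$ is the indicator function of $P$ and $\widehat{g}(t)=\int_{\mathbb{R}^2}g(x)e^{-2\pi i x\cdot t}\,dx$. *)

theory Defs
  imports "HOL-Analysis.Analysis"
begin

text \<open>The plane is \<^typ>\<open>real \<times> real\<close>, whose norm and inner product are the Euclidean ones.\<close>

type_synonym point = "real \<times> real"

text \<open>For nonzero vectors, being parallel means being linearly dependent (opposite directions count).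
  The predicate is only ever applied to unit vectors and to edges, which are nonzero since the
  vertices are distinct.\<close>

definition parallel :: "point \<Rightarrow> point \<Rightarrow> bool" where
  "parallel u v \<longleftrightarrow> collinear {0, u, v}"

definition vertex :: "point list \<Rightarrow> nat \<Rightarrow> point" where
  "vertex vs j = vs ! (j mod length vs)"

definition edge_vector :: "point list \<Rightarrow> nat \<Rightarrow> point" where
  "edge_vector vs j = vertex vs (Suc j) - vertex vs j"

definition edge :: "point list \<Rightarrow> nat \<Rightarrow> point set" where
  "edge vs j = closed_segment (vertex vs j) (vertex vs (Suc j))"

definition boundary_curve :: "point list \<Rightarrow> point set" where
  "boundary_curve vs = (\<Union>j<length vs. edge vs j)"

text \<open>The third condition says that two different edges meet only in a common endpoint; together
  with the vertices being distinct this makes the closed polygonal curve simple.\<close>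

definition simple_polygon :: "point list \<Rightarrow> bool" where
  "simple_polygon vs \<longleftrightarrow>
     length vs \<ge> 3 \<and>
     distinct vs \<and>
     (\<forall>i<length vs. \<forall>j<length vs. i \<noteq> j \<longrightarrow>
        edge vs i \<inter> edge vs j
          = {vertex vs i, vertex vs (Suc i)} \<inter> {vertex vs j, vertex vs (Suc j)}) \<and>
     (\<forall>j<length vs. \<not> parallel (edge_vector vs j) (edge_vector vs (Suc j)))"

text \<open>The library's \<^const>\<open>inside\<close> collects the bounded components of the complement.\<close>

definition polygonal_region :: "point list \<Rightarrow> point set" where
  "polygonal_region vs = inside (boundary_curve vs)"

definition unit_square :: "point set" where
  "unit_square = {0..<1} \<times> {0..<1}"

definition polygon_class :: "nat \<Rightarrow> nat \<Rightarrow> (nat \<Rightarrow> point) \<Rightarrow> point set set" where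
  "polygon_class k N s =
     {P. P \<subseteq> unit_square \<and>
         (\<exists>vs. simple_polygon vs \<and> length vs \<le> N \<and> set vs \<subseteq> unit_square \<and>
               (\<forall>j<length vs. \<exists>i\<in>{1..k}. parallel (edge_vector vs j) (s i)) \<and>
               P = polygonal_region vs)}"

definition fourier :: "(point \<Rightarrow> complex) \<Rightarrow> point \<Rightarrow> complex" where
  "fourier g t = (LINT x|lborel. g x * exp (- 2 * of_real pi * \<i> * of_real (x \<bullet> t)))"

definition sampling_set :: "nat \<Rightarrow> nat \<Rightarrow> (int \<times> int) set" where
  "sampling_set k N =
     (\<Union>r\<in>{1..N}. {0 .. 2 * \<lfloor>2 * real N / real r\<rfloor> * (int k - 1)} \<times> {0 .. 2 * int r * (int k - 1)})"

lemma finite_sampling_set: "finite (sampling_set k N)"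
  by (simp add: sampling_set_def)

definition frequency :: "int \<times> int \<Rightarrow> point" where
  "frequency a = (real_of_int (fst a), real_of_int (snd a))"

end

theory Submission
  imports Defs "HOL-Complex_Analysis.Complex_Analysis"
begin

text \<open>Write \<open>f\<^sub>t(x)\<close> for the plane wave \<open>exp (-2 \<pi> i x\<cdot>t)\<close>. The divergence theorem turns the Fourier transform
  of a polygon into a sum of edge integrals of \<open>f\<^sub>t\<close>, and each of these is a difference of two vertex
  values divided by a linear form of \<open>t\<close>. Multiplying by the product of all the forms \<open>s\<^sub>i\<cdot>t\<close> gives a sum
  of terms \<open>p\<^sub>v(t) f\<^sub>t(v)\<close> over the vertices \<open>v\<close>, where \<open>p\<^sub>v\<close> is a nonzero multiple of the product of the
  \<open>s\<^sub>i\<cdot>t\<close> over the \<open>k - 2\<close> directions that are not taken by an edge at \<open>v\<close>. The difference of two such sums is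
  an exponential polynomial with at most \<open>2N\<close> nodes; if it vanishes on the sampling set then all its coefficients
  vanish. Hence the vertices and the two edge directions at every vertex are determined. On a line of
  direction \<open>s\<^sub>i\<close> the vertices with an edge of this direction are then joined in consecutive pairs, in only one
  possible way, so the boundary curve is determined as well.

  The divergence theorem needs no triangulation: up to a global sign the indicator function is the winding
  number, which is a sum over the edges of signed indicators of the regions above them.\<close>

section \<open>Winding numbers of polygons\<close>

definition det2 :: "point \<Rightarrow> point \<Rightarrow> real" where
  "det2 u v = fst u * snd v - snd u * fst v"

text \<open>The intersection number of the directed edge with the ray going down from
  \<open>z\<close>. In both cases the sign of the determinant says that \<open>z\<close> lies above
  the edge; an edge running to the right counts \<open>1\<close>, an edge running to the left counts
  \<open>- 1\<close>, in accordance with the counterclockwise orientation.\<close>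

definition crossing :: "point \<Rightarrow> point \<Rightarrow> point \<Rightarrow> real" where
  "crossing a b z =
     (if fst a < fst z \<and> fst z < fst b \<and> det2 (b - a) (z - a) > 0 then 1
      else if fst b < fst z \<and> fst z < fst a \<and> det2 (b - a) (z - a) < 0 then - 1 else 0)"

definition cpx :: "point \<Rightarrow> complex" where
  "cpx p = Complex (fst p) (snd p)"

lemma linear_cpx: "linear cpx"
  by (rule linearI) (auto simp: cpx_def complex_eq_iff)

lemma Re_cpx [simp]: "Re (cpx p) = fst p" and Im_cpx [simp]: "Im (cpx p) = snd p"
  by (simp_all add: cpx_def)

lemma inj_cpx: "inj cpx"
  by (auto simp: inj_def complex_eq_iff prod_eq_iff)

lemma winding_number_linepath_primitive:
  fixes F :: "complex \<Rightarrow> complex"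
  assumes "\<And>w. w \<in> closed_segment a b \<Longrightarrow> (F has_field_derivative 1 / (w - z)) (at w)"
    and "z \<notin> closed_segment a b"
  shows "winding_number (linepath a b) z = (F b - F a) / (2 * pi * \<i>)"
proof -
  have "((\<lambda>w. 1 / (w - z)) has_contour_integral (F (pathfinish (linepath a b)) - F (pathstart (linepath a b)))) (linepath a b)"
    by (rule contour_integral_primitive[where S = "closed_segment a b"])
       (auto intro: assms(1) has_field_derivative_at_within)
  then have "contour_integral (linepath a b) (\<lambda>w. 1 / (w - z)) = F b - F a"
    by (simp add: contour_integral_unique)
  then show ?thesis
    using assms(2) by (simp add: winding_number_valid_path)
qed

text \<open>The primitive \<open>Ln (- \<i> * (w - z))\<close> of \<open>1 / (w - z)\<close> has its
  branch cut along the ray going down from \<open>z\<close>, and the second hypothesis keeps the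
  segment off this ray.\<close>

lemma winding_number_linepath_down:
  assumes "z \<notin> closed_segment a b"
    and "\<And>w. w \<in> closed_segment a b \<Longrightarrow> Re w = Re z \<Longrightarrow> Im w > Im z"
  shows "winding_number (linepath a b) z = (Ln (- \<i> * (b - z)) - Ln (- \<i> * (a - z))) / (2 * pi * \<i>)"
proof (rule winding_number_linepath_primitive[OF _ assms(1)])
  fix w assume w: "w \<in> closed_segment a b"
  have "w \<noteq> z" using w assms(1) by auto
  have "- \<i> * (w - z) \<notin> \<real>\<^sub>\<le>\<^sub>0"
    using assms(2)[OF w] by (auto simp: complex_nonpos_Reals_iff)
  then show "((\<lambda>w. Ln (- \<i> * (w - z))) has_field_derivative 1 / (w - z)) (at w)"
    using \<open>w \<noteq> z\<close> by (auto intro!: derivative_eq_intros simp: field_simps)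
qed

text \<open>The mirror image: here the branch cut is the ray going up from \<open>z\<close>.\<close>

lemma winding_number_linepath_up:
  assumes "z \<notin> closed_segment a b"
    and "\<And>w. w \<in> closed_segment a b \<Longrightarrow> Re w = Re z \<Longrightarrow> Im w < Im z"
  shows "winding_number (linepath a b) z = (Ln (\<i> * (b - z)) - Ln (\<i> * (a - z))) / (2 * pi * \<i>)"
proof (rule winding_number_linepath_primitive[OF _ assms(1)])
  fix w assume w: "w \<in> closed_segment a b"
  have "w \<noteq> z" using w assms(1) by auto
  have "\<i> * (w - z) \<notin> \<real>\<^sub>\<le>\<^sub>0"
    using assms(2)[OF w] by (auto simp: complex_nonpos_Reals_iff)
  then show "((\<lambda>w. Ln (\<i> * (w - z))) has_field_derivative 1 / (w - z)) (at w)"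
    using \<open>w \<noteq> z\<close> by (auto intro!: derivative_eq_intros simp: field_simps)
qed

text \<open>Compares the branches with upward and downward cut. They differ by half a turn, whose
  sign depends on the side of the imaginary axis.\<close>

lemma Ln_ii_branches:
  assumes "Re w \<noteq> 0"
  shows "Ln (\<i> * w) = Ln (- \<i> * w) + (if Re w > 0 then 1 else - 1) * \<i> * pi"
proof -
  have w: "w \<noteq> 0" "- \<i> * w \<noteq> 0" using assms by auto
  have "Ln (\<i> * w) = Ln (- (- \<i> * w))" by simp
  also have "\<dots> = Ln (- \<i> * w) + (if Re w > 0 then 1 else - 1) * \<i> * pi"
    using Ln_minus[OF w(2)] assms w by (auto simp: not_le)
  finally show ?thesis .
qed

text \<open>Turns the sign of the determinant into a comparison of the heights of \<open>z\<close>
  and of the point of the segment on the same vertical line.\<close>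

lemma det2_segment:
  assumes "w \<in> closed_segment a b" "fst w = fst z"
  shows "det2 (b - a) (z - a) = (fst b - fst a) * (snd z - snd w)"
proof -
  obtain u where "w = (1 - u) *\<^sub>R a + u *\<^sub>R b" using assms(1) by (auto simp: in_segment)
  then have w: "fst w = (1 - u) * fst a + u * fst b" "snd w = (1 - u) * snd a + u * snd b"
    by auto
  show ?thesis using assms(2) unfolding det2_def by (simp add: w) (simp add: algebra_simps flip: assms(2) add: w)
qed

lemma fst_closed_segment:
  fixes a b w :: point
  assumes "w \<in> closed_segment a b"
  shows "fst w \<in> closed_segment (fst a) (fst b)"
proof -
  obtain u where u: "0 \<le> u" "u \<le> 1" "w = (1 - u) *\<^sub>R a + u *\<^sub>R b" using assms(1) by (auto simp: in_segment)
  then show ?thesis unfolding in_segment by (intro exI[of _ u]) auto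
qed

lemma cpx_segment: "closed_segment (cpx a) (cpx b) = cpx ` closed_segment a b"
  by (rule closed_segment_linear_image[OF linear_cpx])

text \<open>Unless the edge passes below \<open>z\<close>, the logarithm with downward cut is a
  primitive along it and there is no correction. If it does pass below, the logarithm with upward
  cut is used; changing back at both ends costs half the difference of two signs, which is the
  crossing number.\<close>

lemma winding_number_edge:
  assumes z: "z \<notin> closed_segment a b" and ne: "fst a \<noteq> fst z" "fst b \<noteq> fst z"
  defines "L \<equiv> \<lambda>w. Ln (- \<i> * (cpx w - cpx z)) / (2 * pi * \<i>)"
  shows "winding_number (linepath (cpx a) (cpx b)) (cpx z) = L b - L a + of_real (crossing a b z)"
proof -
  have zc: "cpx z \<notin> closed_segment (cpx a) (cpx b)"
    using z by (simp add: cpx_segment inj_image_mem_iff[OF inj_cpx])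
  have LL: "L b - L a = (Ln (- \<i> * (cpx b - cpx z)) - Ln (- \<i> * (cpx a - cpx z))) / (2 * pi * \<i>)"
    by (simp add: L_def diff_divide_distrib)
  have below: "winding_number (linepath (cpx a) (cpx b)) (cpx z) = L b - L a"
    if "\<And>w. w \<in> closed_segment a b \<Longrightarrow> fst w = fst z \<Longrightarrow> snd w > snd z"
    unfolding LL by (rule winding_number_linepath_down[OF zc]) (metis Re_cpx Im_cpx cpx_segment imageE that)
  have above: "winding_number (linepath (cpx a) (cpx b)) (cpx z)
      = L b - L a + ((if fst b > fst z then 1 else - 1) - (if fst a > fst z then 1 else - 1)) / 2"
    if "\<And>w. w \<in> closed_segment a b \<Longrightarrow> fst w = fst z \<Longrightarrow> snd w < snd z"
  proof -
    have "winding_number (linepath (cpx a) (cpx b)) (cpx z) =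
       (Ln (\<i> * (cpx b - cpx z)) - Ln (\<i> * (cpx a - cpx z))) / (2 * pi * \<i>)"
      by (rule winding_number_linepath_up[OF zc]) (metis Re_cpx Im_cpx cpx_segment imageE that)
    also have "\<dots> = L b - L a + ((if fst b > fst z then 1 else - 1) - (if fst a > fst z then 1 else - 1)) / 2"
      unfolding LL using ne Ln_ii_branches[of "cpx b - cpx z"] Ln_ii_branches[of "cpx a - cpx z"]
      by (simp add: field_simps)
    finally show ?thesis .
  qed
  consider "fst a < fst z" "fst z < fst b" | "fst b < fst z" "fst z < fst a"
    | "fst a < fst z" "fst b < fst z" | "fst z < fst a" "fst z < fst b"
    using ne by linarith
  then show ?thesis
  proof cases
    case 1
    show ?thesis
    proof (cases "det2 (b - a) (z - a) > 0")
      case True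
      have "snd w < snd z" if "w \<in> closed_segment a b" "fst w = fst z" for w
        using det2_segment[OF that] True 1 by (simp add: zero_less_mult_iff)
      from above[OF this] show ?thesis using 1 True by (simp add: crossing_def)
    next
      case False
      have "snd w > snd z" if "w \<in> closed_segment a b" "fst w = fst z" for w
      proof -
        have "snd w \<ge> snd z" using det2_segment[OF that] False 1 by (simp add: zero_less_mult_iff)
        moreover have "w \<noteq> z" using that z by auto
        ultimately show ?thesis using that(2) by (auto simp: prod_eq_iff)
      qed
      from below[OF this] show ?thesis using 1 False by (simp add: crossing_def)
    qed
  next
    case 2
    show ?thesis
    proof (cases "det2 (b - a) (z - a) < 0")
      case True
      have "snd w < snd z" if "w \<in> closed_segment a b" "fst w = fst z" for w
        using det2_segment[OF that] True 2 by (simp add: mult_less_0_iff)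
      from above[OF this] show ?thesis using 2 True by (simp add: crossing_def)
    next
      case False
      have "snd w > snd z" if "w \<in> closed_segment a b" "fst w = fst z" for w
      proof -
        have "snd w \<ge> snd z" using det2_segment[OF that] False 2 by (simp add: mult_less_0_iff)
        moreover have "w \<noteq> z" using that z by auto
        ultimately show ?thesis using that(2) by (auto simp: prod_eq_iff)
      qed
      from below[OF this] show ?thesis using 2 False by (simp add: crossing_def)
    qed
  next
    case 3
    have "snd w > snd z" if "w \<in> closed_segment a b" "fst w = fst z" for w
      using fst_closed_segment[OF that(1)] that(2) 3 by (auto simp: closed_segment_eq_real_ivl split: if_splits)
    from below[OF this] show ?thesis using 3 by (simp add: crossing_def)
  next
    case 4
    have "snd w > snd z" if "w \<in> closed_segment a b" "fst w = fst z" for w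
      using fst_closed_segment[OF that(1)] that(2) 4 by (auto simp: closed_segment_eq_real_ivl split: if_splits)
    from below[OF this] show ?thesis using 4 by (simp add: crossing_def)
  qed
qed

section \<open>Polygonal paths\<close>

text \<open>There are \<open>m + 1\<close> segments, from \<open>p 0\<close> to
  \<open>p (m + 1)\<close>, so the closed curve of a polygon with \<open>n\<close> vertices is the
  case \<open>m = n - 1\<close>.\<close>

primrec polypath :: "(nat \<Rightarrow> 'a::real_normed_vector) \<Rightarrow> nat \<Rightarrow> real \<Rightarrow> 'a" where
  "polypath p 0 = linepath (p 0) (p 1)"
| "polypath p (Suc m) = polypath p m +++ linepath (p (Suc m)) (p (Suc (Suc m)))"

lemma pathstart_polypath [simp]: "pathstart (polypath p m) = p 0"
  by (induction m) auto

lemma pathfinish_polypath [simp]: "pathfinish (polypath p m) = p (Suc m)"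
  by (induction m) auto

lemma path_polypath [simp]: "path (polypath p m)"
  by (induction m) auto

lemma path_image_polypath:
  "path_image (polypath p m) = (\<Union>j\<le>m. closed_segment (p j) (p (Suc j)))"
  by (induction m) (auto simp: path_image_join atMost_Suc)

lemma winding_number_polypath:
  assumes "z \<notin> path_image (polypath p m)"
  shows "winding_number (polypath p m) z = (\<Sum>j\<le>m. winding_number (linepath (p j) (p (Suc j))) z)"
  using assms
proof (induction m)
  case (Suc m)
  then show ?case by (simp add: path_image_join winding_number_join)
qed simp

lemma arc_polypath:
  assumes ne: "\<And>j. j \<le> m \<Longrightarrow> p j \<noteq> p (Suc j)"
    and meet: "\<And>i j. i < j \<Longrightarrow> j \<le> m \<Longrightarrow>
       closed_segment (p i) (p (Suc i)) \<inter> closed_segment (p j) (p (Suc j)) \<subseteq> {p j}"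
  shows "arc (polypath p m)"
  using assms
proof (induction m)
  case (Suc m)
  have "arc (polypath p m)" by (rule Suc.IH) (use Suc.prems in auto)
  moreover have "path_image (polypath p m) \<inter> closed_segment (p (Suc m)) (p (Suc (Suc m))) \<subseteq> {p (Suc m)}"
  proof -
    have "closed_segment (p i) (p (Suc i)) \<inter> closed_segment (p (Suc m)) (p (Suc (Suc m))) \<subseteq> {p (Suc m)}"
      if "i \<le> m" for i
      using Suc.prems(2)[of i "Suc m"] that by simp
    then show ?thesis unfolding path_image_polypath by blast
  qed
  ultimately show ?case
    using Suc.prems(1)[of "Suc m"] by (simp add: arc_join)
qed simp

section \<open>The inside of a curve, in the plane and in the complex numbers\<close>

text \<open>Speaking of arbitrary connected sets instead of components gives a form that carries
  over directly along a linear isomorphism.\<close>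

lemma mem_inside_iff:
  "z \<in> inside S \<longleftrightarrow> z \<notin> S \<and> (\<forall>C. connected C \<and> z \<in> C \<and> C \<inter> S = {} \<longrightarrow> bounded C)"
proof -
  have "bounded C" if "bounded (connected_component_set (- S) z)" "connected C" "z \<in> C" "C \<inter> S = {}" for C
    using connected_component_maximal[of z C "- S"] that by (auto intro: bounded_subset)
  moreover have "connected_component_set (- S) z \<inter> S = {}"
    using connected_component_subset by blast
  ultimately show ?thesis
    by (auto simp: inside_def)
qed

lemma bounded_linear_cpx: "bounded_linear cpx"
  using linear_cpx by (simp add: linear_conv_bounded_linear)

lemma bounded_linear_Re_Im: "bounded_linear (\<lambda>c. (Re c, Im c))"
  by (intro bounded_linear_Pair bounded_linear_Re bounded_linear_Im)

lemma inside_cpx_image: "cpx z \<in> inside (cpx ` S) \<longleftrightarrow> z \<in> inside S"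
proof
  assume z: "cpx z \<in> inside (cpx ` S)"
  show "z \<in> inside S"
    unfolding mem_inside_iff
  proof (intro conjI allI impI)
    show "z \<notin> S" using z by (auto simp: mem_inside_iff)
    fix C assume C: "connected C \<and> z \<in> C \<and> C \<inter> S = {}"
    have "connected (cpx ` C)"
      using C bounded_linear_cpx by (intro connected_continuous_image) (auto intro: linear_continuous_on)
    moreover have "cpx ` C \<inter> cpx ` S = {}"
      using C by (simp add: image_Int[OF inj_cpx, symmetric])
    ultimately have "bounded (cpx ` C)"
      using z C by (auto simp: mem_inside_iff)
    then have "bounded ((\<lambda>c. (Re c, Im c)) ` cpx ` C)"
      by (rule bounded_linear_image[OF _ bounded_linear_Re_Im])
    then show "bounded C" by (simp add: image_image)
  qed
next
  assume z: "z \<in> inside S"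
  show "cpx z \<in> inside (cpx ` S)"
    unfolding mem_inside_iff
  proof (intro conjI allI impI)
    show "cpx z \<notin> cpx ` S" using z by (simp add: mem_inside_iff inj_image_mem_iff[OF inj_cpx])
    fix C assume C: "connected C \<and> cpx z \<in> C \<and> C \<inter> cpx ` S = {}"
    define D where "D = (\<lambda>c. (Re c, Im c)) ` C"
    have CD: "C = cpx ` D"
      by (simp add: D_def image_image cpx_def)
    have "connected D"
      unfolding D_def using C bounded_linear_Re_Im by (intro connected_continuous_image) (auto intro: linear_continuous_on)
    moreover have "D \<inter> S = {}" "z \<in> D"
      using C by (auto simp: CD inj_image_mem_iff[OF inj_cpx])
    ultimately have "bounded D"
      using z by (auto simp: mem_inside_iff)
    then show "bounded C"
      unfolding CD by (rule bounded_linear_image[OF _ bounded_linear_cpx])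
  qed
qed

section \<open>The boundary of a polygon as a simple closed path\<close>

lemma vertex_mod [simp]: "vertex vs (j mod length vs) = vertex vs j"
  by (simp add: vertex_def)

lemma vertex_add_length [simp]: "vertex vs (length vs) = vertex vs 0"
  by (simp add: vertex_def)

lemma vertex_eq_iff:
  assumes "distinct vs" "vs \<noteq> []"
  shows "vertex vs i = vertex vs j \<longleftrightarrow> i mod length vs = j mod length vs"
  using assms by (simp add: vertex_def nth_eq_iff_index_eq)

lemma vertex_neq:
  assumes "distinct vs" "i < length vs" "j < length vs" "i \<noteq> j"
  shows "vertex vs i \<noteq> vertex vs j"
  using assms by (simp add: vertex_def nth_eq_iff_index_eq)

lemma path_image_boundary:
  assumes "vs \<noteq> []"
  shows "path_image (polypath (\<lambda>j. cpx (vertex vs j)) (length vs - 1)) = cpx ` boundary_curve vs"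
proof -
  have "{..length vs - 1} = {..<length vs}" using assms by (cases vs) auto
  then show ?thesis
    unfolding path_image_polypath boundary_curve_def edge_def image_UN by (simp add: cpx_segment)
qed

text \<open>All edges but the last form an arc, and the last edge closes it, meeting it only in the
  two ends of the arc.\<close>

lemma simple_path_polygon:
  assumes "simple_polygon vs"
  shows "simple_path (polypath (\<lambda>j. cpx (vertex vs j)) (length vs - 1))"
proof -
  define n where "n = length vs"
  define p where "p = (\<lambda>j. cpx (vertex vs j))"
  have n: "n \<ge> 3" "distinct vs" and
    meet: "\<And>i j. i < n \<Longrightarrow> j < n \<Longrightarrow> i \<noteq> j \<Longrightarrow> edge vs i \<inter> edge vs j
          = {vertex vs i, vertex vs (Suc i)} \<inter> {vertex vs j, vertex vs (Suc j)}"
    using assms unfolding simple_polygon_def n_def by auto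
  have neq: "vertex vs i \<noteq> vertex vs j" if "i < n" "j < n" "i \<noteq> j" for i j
    using vertex_neq[OF n(2)] that by (simp add: n_def)
  have pn: "p n = p 0" by (simp add: p_def n_def)
  \<comment> \<open>With this \<open>m\<close>, \<open>polypath p m\<close> consists of the edges
    \<open>0\<close> to \<open>n - 2\<close>.\<close>
  obtain m where m: "n = Suc (Suc m)" using n(1) by (metis Suc_le_D numeral_3_eq_3 Suc_le_mono)
  have meetc: "closed_segment (p i) (p (Suc i)) \<inter> closed_segment (p j) (p (Suc j)) =
      {p i, p (Suc i)} \<inter> {p j, p (Suc j)}" if "i < n" "j < n" "i \<noteq> j" for i j
  proof -
    have "closed_segment (p i) (p (Suc i)) \<inter> closed_segment (p j) (p (Suc j)) = cpx ` (edge vs i \<inter> edge vs j)"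
      by (simp add: p_def cpx_segment edge_def image_Int[OF inj_cpx])
    also have "\<dots> = {p i, p (Suc i)} \<inter> {p j, p (Suc j)}"
      unfolding meet[OF that] image_Int[OF inj_cpx] by (simp add: p_def)
    finally show ?thesis .
  qed
  have pneq: "p i \<noteq> p j" if "i < n" "j < n" "i \<noteq> j" for i j
    using neq[OF that] injD[OF inj_cpx] unfolding p_def by blast
  have arc1: "arc (polypath p m)"
  proof (rule arc_polypath)
    show "p j \<noteq> p (Suc j)" if "j \<le> m" for j using that m by (intro pneq) auto
    \<comment> \<open>Of the four possible coincidences of endpoints only
      \<open>p (Suc i) = p j\<close> remains: there is no wrap-around, because
      \<open>Suc j < n\<close>.\<close>
    fix i j assume ij: "i < j" "j \<le> m"
    then have "p i \<noteq> p j" "p i \<noteq> p (Suc j)" "p (Suc i) \<noteq> p (Suc j)"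
      using ij m pneq[of i j] pneq[of i "Suc j"] pneq[of "Suc i" "Suc j"] by auto
    then show "closed_segment (p i) (p (Suc i)) \<inter> closed_segment (p j) (p (Suc j)) \<subseteq> {p j}"
      using meetc[of i j] ij m by auto
  qed
  have "simple_path (polypath p m +++ linepath (p (Suc m)) (p (Suc (Suc m))))"
  proof (rule simple_path_join_loop)
    show "arc (linepath (p (Suc m)) (p (Suc (Suc m))))"
      using pneq[of "Suc m" 0] pn m by simp
    have "closed_segment (p i) (p (Suc i)) \<inter> closed_segment (p (Suc m)) (p (Suc (Suc m))) \<subseteq> {p (Suc m), p (Suc (Suc m))}"
      if "i \<le> m" for i
      using meetc[of i "Suc m"] that m by auto
    then show "path_image (polypath p m) \<inter> path_image (linepath (p (Suc m)) (p (Suc (Suc m))))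
      \<subseteq> {pathstart (polypath p m), pathstart (linepath (p (Suc m)) (p (Suc (Suc m))))}"
      using pn m by (simp add: path_image_polypath) blast
  qed (use arc1 pn m in auto)
  moreover have "length vs - 1 = Suc m" using m n_def by simp
  ultimately show ?thesis by (simp add: p_def)
qed

text \<open>The winding number is the sum over the edges of the increments of a logarithm cut along the
  downward ray, corrected by one whenever an edge crosses the cut; the increments telescope.\<close>

lemma indicator_region_eq_crossings:
  assumes "simple_polygon vs"
  obtains \<epsilon> :: real where "\<epsilon> \<in> {1, - 1}"
    "\<And>z. z \<notin> boundary_curve vs \<Longrightarrow> (\<And>j. fst (vertex vs j) \<noteq> fst z) \<Longrightarrow>
       \<epsilon> * indicator (polygonal_region vs) z
         = (\<Sum>j<length vs. crossing (vertex vs j) (vertex vs (Suc j)) z)"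
proof -
  define \<gamma> where "\<gamma> = polypath (\<lambda>j. cpx (vertex vs j)) (length vs - 1)"
  have ne: "vs \<noteq> []" using assms by (auto simp: simple_polygon_def)
  have simple: "simple_path \<gamma>" unfolding \<gamma>_def by (rule simple_path_polygon[OF assms])
  have img: "path_image \<gamma> = cpx ` boundary_curve vs"
    unfolding \<gamma>_def by (rule path_image_boundary[OF ne])
  have closed: "pathfinish \<gamma> = pathstart \<gamma>"
    using ne by (simp add: \<gamma>_def)
  \<comment> \<open>The orientation of the vertex list is not known, so the winding number is
    determined only up to this sign.\<close>
  have "\<exists>\<epsilon>::real. \<epsilon> \<in> {1, - 1} \<and> (\<forall>z. z \<in> inside (path_image \<gamma>) \<longrightarrow> winding_number \<gamma> z = of_real \<epsilon>)"
    by (rule simple_closed_path_winding_number_inside[OF simple])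
       (metis insertI1 of_real_1, metis insertI1 insertI2 of_real_1 of_real_minus)
  then obtain \<epsilon> :: real where eps: "\<epsilon> \<in> {1, - 1}"
    and wn: "\<And>z. z \<in> inside (path_image \<gamma>) \<Longrightarrow> winding_number \<gamma> z = of_real \<epsilon>"
    by blast
  have "\<epsilon> * indicator (polygonal_region vs) z
         = (\<Sum>j<length vs. crossing (vertex vs j) (vertex vs (Suc j)) z)"
    if z: "z \<notin> boundary_curve vs" and fz: "\<And>j. fst (vertex vs j) \<noteq> fst z" for z
  proof -
    have zi: "cpx z \<notin> path_image \<gamma>" using z by (simp add: img inj_image_mem_iff[OF inj_cpx])
    have "winding_number \<gamma> (cpx z) = of_real (\<epsilon> * indicator (polygonal_region vs) z)"
    proof (cases "z \<in> polygonal_region vs")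
      case True
      then have "cpx z \<in> inside (path_image \<gamma>)"
        by (simp add: img polygonal_region_def inside_cpx_image)
      then show ?thesis using wn True by simp
    next
      case False
      then have "cpx z \<notin> inside (path_image \<gamma>)"
        by (simp add: img polygonal_region_def inside_cpx_image)
      then have "cpx z \<in> outside (path_image \<gamma>)"
        using zi inside_Un_outside[of "path_image \<gamma>"] by blast
      then have "winding_number \<gamma> (cpx z) = 0"
        using simple closed by (intro winding_number_zero_in_outside) (auto simp: simple_path_imp_path)
      then show ?thesis using False by simp
    qed
    moreover have "winding_number \<gamma> (cpx z) =
       of_real (\<Sum>j<length vs. crossing (vertex vs j) (vertex vs (Suc j)) z)"
    proof -
      define L where "L = (\<lambda>w. Ln (- \<i> * (cpx w - cpx z)) / (2 * pi * \<i>))"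
      have atm: "{..length vs - 1} = {..<length vs}" using ne by (cases vs) auto
      have "winding_number \<gamma> (cpx z) =
         (\<Sum>j<length vs. winding_number (linepath (cpx (vertex vs j)) (cpx (vertex vs (Suc j)))) (cpx z))"
        using winding_number_polypath zi unfolding \<gamma>_def atm[symmetric] by blast
      also have "\<dots> = (\<Sum>j<length vs. L (vertex vs (Suc j)) - L (vertex vs j)
                       + of_real (crossing (vertex vs j) (vertex vs (Suc j)) z))"
      proof (rule sum.cong[OF refl])
        fix j assume "j \<in> {..<length vs}"
        then have "z \<notin> closed_segment (vertex vs j) (vertex vs (Suc j))"
          using z by (auto simp: boundary_curve_def edge_def)
        then show "winding_number (linepath (cpx (vertex vs j)) (cpx (vertex vs (Suc j)))) (cpx z) =
           L (vertex vs (Suc j)) - L (vertex vs j) + of_real (crossing (vertex vs j) (vertex vs (Suc j)) z)"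
          unfolding L_def by (rule winding_number_edge) (use fz in auto)
      qed
      also have "\<dots> = L (vertex vs (length vs)) - L (vertex vs 0)
           + of_real (\<Sum>j<length vs. crossing (vertex vs j) (vertex vs (Suc j)) z)"
        by (simp add: sum.distrib sum_lessThan_telescope[of "\<lambda>j. L (vertex vs j)"])
      finally show ?thesis by simp
    qed
    ultimately show ?thesis using of_real_eq_iff by metis
  qed
  then show ?thesis using that eps by blast
qed

section \<open>The Fourier transform of a polygonal region\<close>

definition plane_wave :: "point \<Rightarrow> point \<Rightarrow> complex" where
  "plane_wave t x = exp (- 2 * of_real pi * \<i> * of_real (x \<bullet> t))"

lemma plane_wave_vector_derivative:
  assumes "(g has_vector_derivative g') (at x within S)"
  shows "((\<lambda>x. plane_wave t (g x)) has_vector_derivative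
           (- 2 * of_real pi * \<i> * of_real (g' \<bullet> t)) * plane_wave t (g x)) (at x within S)"
proof -
  have "((\<lambda>x. - 2 * of_real pi * \<i> * complex_of_real (g x \<bullet> t)) has_vector_derivative
          - 2 * of_real pi * \<i> * of_real (g' \<bullet> t)) (at x within S)"
    using assms
    by (intro has_vector_derivative_mult_right has_vector_derivative_of_real)
       (auto intro!: derivative_eq_intros simp: has_vector_derivative_def has_real_derivative_iff_has_vector_derivative)
  then have "((exp \<circ> (\<lambda>x. - 2 * of_real pi * \<i> * complex_of_real (g x \<bullet> t))) has_vector_derivative
      (- 2 * of_real pi * \<i> * of_real (g' \<bullet> t)) * exp (- 2 * of_real pi * \<i> * of_real (g x \<bullet> t))) (at x within S)"
    by (intro field_vector_diff_chain_within) (auto intro: DERIV_exp has_field_derivative_at_within)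
  then show ?thesis by (simp add: plane_wave_def o_def)
qed

lemma continuous_on_plane_wave [continuous_intros]:
  "continuous_on S g \<Longrightarrow> continuous_on S (\<lambda>x. plane_wave t (g x))"
  unfolding plane_wave_def by (intro continuous_intros)

lemma plane_wave_borel [measurable]: "plane_wave t \<in> borel_measurable borel"
  by (intro borel_measurable_continuous_onI continuous_intros)

text \<open>For the contribution of the line \<open>y = 1\<close>, up to which the regions above the
  edges are cut off. The increments of \<open>\<Phi>\<close> cancel around a closed polygon.\<close>

lemma plane_wave_top_antiderivative:
  obtains \<Phi> where "\<And>x S. (\<Phi> has_vector_derivative plane_wave t (x, 1)) (at x within S)"
proof (cases "fst t = 0")
  case True
  have "((\<lambda>x. x *\<^sub>R plane_wave t (0, 1)) has_vector_derivative plane_wave t (x, 1)) (at x within S)" for x S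
  proof -
    have "plane_wave t (x, 1) = plane_wave t (0, 1)"
      using True by (cases t) (simp add: plane_wave_def)
    then show ?thesis by (auto intro!: derivative_eq_intros simp: has_vector_derivative_def)
  qed
  then show ?thesis using that by blast
next
  case False
  have "((\<lambda>x. plane_wave t (x, 1) / (- 2 * of_real pi * \<i> * of_real (fst t))) has_vector_derivative plane_wave t (x, 1)) (at x within S)" for x S
  proof -
    have "((\<lambda>x. (x, 1::real)) has_vector_derivative (1, 0)) (at x within S)"
      by (auto intro!: derivative_eq_intros simp: has_vector_derivative_def)
    from has_vector_derivative_divide[OF plane_wave_vector_derivative[OF this, of t], of "- 2 * of_real pi * \<i> * of_real (fst t)"]
    show ?thesis using False by (cases t) simp
  qed
  then show ?thesis using that by blast
qed

section \<open>The flux of a plane wave through one edge\<close>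

text \<open>For a vertical line the division by zero makes this \<open>0\<close>.\<close>

definition line_height :: "point \<Rightarrow> point \<Rightarrow> real \<Rightarrow> real" where
  "line_height a b x = (snd a * (fst b - x) + snd b * (x - fst a)) / (fst b - fst a)"

lemma det2_pos_iff_above:
  assumes "fst a < fst b"
  shows "det2 (b - a) (z - a) > 0 \<longleftrightarrow> line_height a b (fst z) < snd z"
proof -
  have "det2 (b - a) (z - a) = (fst b - fst a) * snd z - (snd a * (fst b - fst z) + snd b * (fst z - fst a))"
    by (simp add: det2_def algebra_simps)
  then show ?thesis
    using assms by (simp add: line_height_def pos_divide_less_eq mult.commute)
qed

lemma line_height_bounds:
  assumes "a \<in> unit_square" "b \<in> unit_square" "fst a < fst b" "fst a \<le> x" "x \<le> fst b"
  shows "0 \<le> line_height a b x" "line_height a b x < 1"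
proof -
  have y: "0 \<le> snd a" "snd a < 1" "0 \<le> snd b" "snd b < 1"
    using assms by (auto simp: unit_square_def mem_Times_iff)
  show "0 \<le> line_height a b x"
    unfolding line_height_def using y assms by (intro divide_nonneg_pos add_nonneg_nonneg mult_nonneg_nonneg) auto
  have "snd a * (fst b - x) + snd b * (x - fst a) < 1 * (fst b - x) + 1 * (x - fst a)"
  proof (cases "x = fst b")
    case True
    then show ?thesis using y assms by (simp add: mult_less_cancel_right)
  next
    case False
    then show ?thesis using y assms
      by (intro add_less_le_mono mult_strict_right_mono mult_right_mono) auto
  qed
  then show "line_height a b x < 1"
    unfolding line_height_def using assms by (simp add: pos_divide_less_eq)
qed

text \<open>The signed integral of the vertical derivative of the wave over the region between the
  edge and the line \<open>y = 1\<close>. The cut-off makes the region bounded, and a polygonal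
  region inside the unit square is not affected by it.\<close>

definition edge_integral :: "point \<Rightarrow> point \<Rightarrow> point \<Rightarrow> complex" where
  "edge_integral t a b = (LINT z|lborel. (crossing a b z * indicator {z. snd z < 1} z) *\<^sub>R
      (- 2 * of_real pi * \<i> * of_real (snd t) * plane_wave t z))"

text \<open>By Fubini and the fundamental theorem in the vertical direction, the integral is an
  integral of the wave along the line \<open>y = 1\<close> minus one along the edge. The latter is
  the integral of an exponential of a linear function, hence, after multiplication by the derivative
  of the exponent, a difference of endpoint values.\<close>

lemma edge_integral_pos:
  assumes ab: "a \<in> unit_square" "b \<in> unit_square" "fst a < fst b"
    and \<Phi>: "\<And>x S. (\<Phi> has_vector_derivative plane_wave t (x, 1)) (at x within S)"
  defines "c \<equiv> - 2 * of_real pi * \<i>"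
  shows "integrable lborel (\<lambda>z. (crossing a b z * indicator {z. snd z < 1} z) *\<^sub>R (c * of_real (snd t) * plane_wave t z))" (is ?int)
    and "c * of_real ((b - a) \<bullet> t) * (\<Phi> (fst b) - \<Phi> (fst a) - edge_integral t a b)
       = of_real (fst b - fst a) * (plane_wave t b - plane_wave t a)" (is ?eq)
proof -
  define h where "h = line_height a b"
  define f where "f = (\<lambda>z. c * of_real (snd t) * plane_wave t z)"
  define R where "R = {z. fst a < fst z \<and> fst z < fst b \<and> h (fst z) < snd z \<and> snd z < 1}"
  have hcont: "continuous_on S h" for S
    unfolding h_def line_height_def using ab by (intro continuous_intros) auto
  have fcont: "continuous_on S f" for S
    unfolding f_def by (intro continuous_intros)
  have eqR: "(crossing a b z * indicator {z. snd z < 1} z) *\<^sub>R f z = indicator R z *\<^sub>R f z" for z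
    using ab(3) by (auto simp: crossing_def R_def h_def det2_pos_iff_above indicator_def)
  have "open R"
    unfolding R_def using hcont[of UNIV]
    by (intro open_Collect_conj open_Collect_less continuous_intros continuous_on_compose2[OF hcont[of UNIV]]) auto
  then have Rm: "R \<in> sets lborel" by simp
  have "R \<subseteq> cbox (fst a, 0) (fst b, 1)"
  proof
    fix z assume "z \<in> R"
    then show "z \<in> cbox (fst a, 0) (fst b, 1)"
      using line_height_bounds[OF ab, of "fst z"] by (cases z) (auto simp: R_def h_def cbox_Pair_eq)
  qed
  moreover have "set_integrable lborel (cbox (fst a, 0) (fst b, 1)) f"
    unfolding set_integrable_def by (intro borel_integrable_compact fcont) auto
  ultimately have "set_integrable lborel R f"
    using Rm set_integrable_subset by blast
  then have intR: "integrable (lborel \<Otimes>\<^sub>M lborel) (\<lambda>z. indicator R z *\<^sub>R f z)"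
    by (simp add: set_integrable_def lborel_prod)
  then show ?int unfolding eqR[unfolded f_def] by (simp add: lborel_prod f_def)
  have inner: "(LINT y|lborel. indicator R (x, y) *\<^sub>R f (x, y)) =
      indicator {fst a<..<fst b} x *\<^sub>R (plane_wave t (x, 1) - plane_wave t (x, h x))" for x
  proof (cases "fst a < x \<and> x < fst b")
    case True
    then have hx: "h x < 1" using line_height_bounds[OF ab] by (auto simp: h_def)
    have [measurable]: "(\<lambda>y. f (x, y)) \<in> borel_measurable borel"
      by (intro borel_measurable_continuous_onI continuous_on_compose2[OF fcont[of UNIV]] continuous_intros) auto
    have "AE y in lborel. y \<noteq> h x" "AE y in lborel. y \<noteq> 1"
      by (auto intro: AE_lborel_singleton)
    then have ae: "AE y in lborel. indicator R (x, y) *\<^sub>R f (x, y) = indicator {h x..1} y *\<^sub>R f (x, y)"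
      by eventually_elim (use True in \<open>auto simp: R_def indicator_def\<close>)
    have Rx: "(\<lambda>y. indicator R (x, y) *\<^sub>R f (x, y)) = (\<lambda>y. indicator {h x<..<1} y *\<^sub>R f (x, y))"
      using True by (auto simp: R_def indicator_def)
    have "(LINT y|lborel. indicator R (x, y) *\<^sub>R f (x, y)) = (LINT y|lborel. indicator {h x..1} y *\<^sub>R f (x, y))"
      using ae by (intro integral_cong_AE) (auto simp: Rx)
    also have "\<dots> = plane_wave t (x, 1) - plane_wave t (x, h x)"
    proof (rule integral_FTC_Icc)
      show "h x \<le> 1" using hx by simp
      show "continuous_on {h x..1} (\<lambda>y. f (x, y))"
        by (intro continuous_on_compose2[OF fcont[of UNIV]] continuous_intros) auto
      fix y
      have "((\<lambda>y. (x, y)) has_vector_derivative (0, 1)) (at y within {h x..1})"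
        by (auto intro!: derivative_eq_intros simp: has_vector_derivative_def)
      from plane_wave_vector_derivative[OF this, of t]
      show "((\<lambda>y. plane_wave t (x, y)) has_vector_derivative f (x, y)) (at y within {h x..1})"
        by (cases t) (simp add: f_def c_def)
    qed
    finally show ?thesis using True by simp
  qed (auto simp: R_def)
  define K where "K = (LINT x|lborel. indicator {fst a..fst b} x *\<^sub>R plane_wave t (x, h x))"
  have wh: "continuous_on {fst a..fst b} (\<lambda>x. plane_wave t (x, h x))"
    by (intro continuous_intros hcont)
  have w1: "continuous_on {fst a..fst b} (\<lambda>x. plane_wave t (x, 1))"
    by (intro continuous_intros)
  have [measurable]: "(\<lambda>x. plane_wave t (x, h x)) \<in> borel_measurable borel" "(\<lambda>x. plane_wave t (x, 1)) \<in> borel_measurable borel"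
    by (intro borel_measurable_continuous_onI continuous_intros hcont)+
  have "edge_integral t a b = (LINT z|(lborel \<Otimes>\<^sub>M lborel). indicator R z *\<^sub>R f z)"
    unfolding edge_integral_def c_def[symmetric] lborel_prod eqR[unfolded f_def] f_def ..
  also have "\<dots> = (LINT x|lborel. LINT y|lborel. indicator R (x, y) *\<^sub>R f (x, y))"
    by (rule lborel_pair.integral_fst'[OF intR, symmetric])
  also have "\<dots> = (LINT x|lborel. indicator {fst a<..<fst b} x *\<^sub>R (plane_wave t (x, 1) - plane_wave t (x, h x)))"
    by (simp only: inner)
  also have "\<dots> = (LINT x|lborel. indicator {fst a..fst b} x *\<^sub>R plane_wave t (x, 1) - indicator {fst a..fst b} x *\<^sub>R plane_wave t (x, h x))"
  proof (rule integral_cong_AE)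
    have "AE x in lborel. x \<noteq> fst a" "AE x in lborel. x \<noteq> fst b"
      by (auto intro: AE_lborel_singleton)
    then show "AE x in lborel. indicator {fst a<..<fst b} x *\<^sub>R (plane_wave t (x, 1) - plane_wave t (x, h x))
       = indicator {fst a..fst b} x *\<^sub>R plane_wave t (x, 1) - indicator {fst a..fst b} x *\<^sub>R plane_wave t (x, h x)"
      by eventually_elim (auto simp: indicator_def)
  qed auto
  also have "\<dots> = (LINT x|lborel. indicator {fst a..fst b} x *\<^sub>R plane_wave t (x, 1)) - K"
    unfolding K_def by (intro Bochner_Integration.integral_diff borel_integrable_compact w1 wh) auto
  also have "(LINT x|lborel. indicator {fst a..fst b} x *\<^sub>R plane_wave t (x, 1)) = \<Phi> (fst b) - \<Phi> (fst a)"
    using ab by (intro integral_FTC_Icc \<Phi> w1) auto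
  finally have I: "\<Phi> (fst b) - \<Phi> (fst a) - edge_integral t a b = K" by simp
  \<comment> \<open>The slope of the edge; \<open>(1, m)\<close> is the velocity of the
    parametrization of the edge by its abscissa.\<close>
  define m where "m = (snd b - snd a) / (fst b - fst a)"
  have hd: "(h has_vector_derivative m) (at x within S)" for x S
    unfolding h_def line_height_def m_def using ab
    by (auto intro!: derivative_eq_intros simp flip: has_real_derivative_iff_has_vector_derivative)
  have "c * of_real ((1, m) \<bullet> t) * K = (LINT x|lborel. indicator {fst a..fst b} x *\<^sub>R (c * of_real ((1, m) \<bullet> t) * plane_wave t (x, h x)))"
    unfolding K_def by (subst integral_mult_right_zero[symmetric]) (simp add: scaleR_conv_of_real mult.left_commute)
  also have "\<dots> = plane_wave t (fst b, h (fst b)) - plane_wave t (fst a, h (fst a))"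
  proof (rule integral_FTC_Icc)
    fix x
    have "((\<lambda>x. (x, h x)) has_vector_derivative (1, m)) (at x within {fst a..fst b})"
      using hd by (intro has_vector_derivative_Pair has_vector_derivative_id) auto
    from plane_wave_vector_derivative[OF this, of t]
    show "((\<lambda>x. plane_wave t (x, h x)) has_vector_derivative c * of_real ((1, m) \<bullet> t) * plane_wave t (x, h x)) (at x within {fst a..fst b})"
      by (simp add: c_def)
  qed (use ab in \<open>auto intro!: continuous_intros hcont\<close>)
  also have "(fst b, h (fst b)) = b"
    using ab by (auto simp: h_def line_height_def prod_eq_iff)
  also have "(fst a, h (fst a)) = a"
    using ab by (auto simp: h_def line_height_def prod_eq_iff)
  finally have K: "c * of_real ((1, m) \<bullet> t) * K = plane_wave t b - plane_wave t a" .
  have "(b - a) \<bullet> t = (fst b - fst a) * ((1, m) \<bullet> t)"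
    using ab by (cases t; cases a; cases b) (simp add: m_def field_simps)
  then show ?eq unfolding I K[symmetric] by simp
qed

lemma crossing_swap: "crossing b a z = - crossing a b z"
proof -
  have "det2 (a - b) (z - b) = - det2 (b - a) (z - a)"
    by (simp add: det2_def algebra_simps)
  then show ?thesis by (simp add: crossing_def)
qed

text \<open>For a vertical edge both sides of the equation are zero, and an edge running to the left
  is a reversed edge with the opposite sign.\<close>

lemma edge_integral:
  assumes ab: "a \<in> unit_square" "b \<in> unit_square"
    and \<Phi>: "\<And>x S. (\<Phi> has_vector_derivative plane_wave t (x, 1)) (at x within S)"
  defines "c \<equiv> - 2 * of_real pi * \<i>"
  shows "integrable lborel (\<lambda>z. (crossing a b z * indicator {z. snd z < 1} z) *\<^sub>R (c * of_real (snd t) * plane_wave t z))" (is ?int)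
    and "c * of_real ((b - a) \<bullet> t) * (\<Phi> (fst b) - \<Phi> (fst a) - edge_integral t a b)
       = of_real (fst b - fst a) * (plane_wave t b - plane_wave t a)" (is ?eq)
proof -
  consider "fst a < fst b" | "fst a = fst b" | "fst b < fst a" by linarith
  then have "?int \<and> ?eq"
  proof cases
    case 1
    then show ?thesis unfolding c_def using edge_integral_pos[OF ab _ \<Phi>] by blast
  next
    case 2
    then have "crossing a b z = 0" for z by (auto simp: crossing_def)
    then show ?thesis using 2 by (simp add: edge_integral_def)
  next
    case 3
    note pos = edge_integral_pos[OF ab(2,1) 3 \<Phi>, folded c_def]
    have "edge_integral t a b = - edge_integral t b a"
      unfolding edge_integral_def crossing_swap[of a b] by simp
    moreover have "(a - b) \<bullet> t = - ((b - a) \<bullet> t)" by (simp add: inner_diff_left)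
    ultimately have ?eq using pos(2) by (simp add: algebra_simps)
    moreover have ?int
      using Bochner_Integration.integrable_minus[OF pos(1)] unfolding crossing_swap[of a b] by simp
    ultimately show ?thesis by blast
  qed
  then show ?int ?eq by blast+
qed

section \<open>Parallel vectors and null sets\<close>

lemma det2_scale: "det2 (c *\<^sub>R u) v = c * det2 u v"
  by (simp add: det2_def algebra_simps)

lemma det2_eq_0_imp_multiple:
  assumes "det2 u v = 0" "v \<noteq> 0"
  obtains c where "u = c *\<^sub>R v"
proof -
  have "u = (if fst v \<noteq> 0 then fst u / fst v else snd u / snd v) *\<^sub>R v"
    using assms by (auto simp: det2_def prod_eq_iff field_simps)
  then show ?thesis using that by blast
qed

lemma parallel_iff_det2: "parallel u v \<longleftrightarrow> det2 u v = 0"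
proof (cases "v = 0")
  case False
  have "parallel u v \<longleftrightarrow> collinear {0, v, u}"
    by (simp add: parallel_def insert_commute)
  also have "\<dots> \<longleftrightarrow> (\<exists>c. u = c *\<^sub>R v)"
    using False by (auto simp: collinear_lemma intro: exI[of _ 0])
  also have "\<dots> \<longleftrightarrow> det2 u v = 0"
  proof
    show "det2 u v = 0" if "\<exists>c. u = c *\<^sub>R v"
      using that by (auto simp: det2_def)
  qed (metis det2_eq_0_imp_multiple[OF _ False])
  finally show ?thesis .
qed (simp add: parallel_def det2_def insert_commute)

lemma AE_not_negligible:
  assumes "negligible S" shows "AE z in lborel. z \<notin> S"
proof -
  have "AE z in lebesgue. z \<notin> S"
    using assms by (auto simp: negligible_iff_null_sets intro: AE_not_in)
  then show ?thesis by (simp add: AE_completion_iff)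
qed

lemma negligible_boundary_curve:
  assumes "simple_polygon vs"
  shows "negligible (boundary_curve vs)"
  unfolding boundary_curve_def
proof (rule negligible_Union[OF finite_imageI[OF finite_lessThan]], clarify)
  fix j assume j: "j < length vs"
  define u where "u = edge_vector vs j"
  have u: "u \<noteq> 0"
    using assms j by (auto simp: simple_polygon_def u_def parallel_iff_det2 det2_def)
  have "edge vs j \<subseteq> {z. (- snd u, fst u) \<bullet> z = (- snd u, fst u) \<bullet> vertex vs j}"
  proof
    fix z assume "z \<in> edge vs j"
    then obtain r where "z = (1 - r) *\<^sub>R vertex vs j + r *\<^sub>R vertex vs (Suc j)"
      by (auto simp: edge_def in_segment)
    then have "z = vertex vs j + r *\<^sub>R u"
      by (simp add: u_def edge_vector_def algebra_simps)
    then show "z \<in> {z. (- snd u, fst u) \<bullet> z = (- snd u, fst u) \<bullet> vertex vs j}"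
      by (cases u) (simp add: inner_add_right)
  qed
  moreover have "negligible {z. (- snd u, fst u) \<bullet> z = (- snd u, fst u) \<bullet> vertex vs j}"
    using u by (intro negligible_hyperplane) (auto simp: prod_eq_iff)
  ultimately show "negligible (edge vs j)" by (rule negligible_subset[rotated])
qed

lemma vertex_in_set: "vs \<noteq> [] \<Longrightarrow> vertex vs j \<in> set vs"
  by (simp add: vertex_def)

lemma closed_boundary_curve: "closed (boundary_curve vs)"
  by (auto simp: boundary_curve_def edge_def)

lemma polygonal_region_borel [measurable]: "polygonal_region vs \<in> sets borel"
  using open_inside[OF closed_boundary_curve, of vs] by (simp add: polygonal_region_def)

text \<open>The divergence theorem for the vertical derivative of a plane wave; \<^term>\<open>K j\<close> stands for
  the flux through the edge \<^term>\<open>j\<close>, and the multiplied form makes sense for edges orthogonal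
  to \<^term>\<open>t\<close> too.\<close>

lemma fourier_polygon_edges:
  assumes vs: "simple_polygon vs" "set vs \<subseteq> unit_square"
    and sub: "polygonal_region vs \<subseteq> unit_square"
  defines "c \<equiv> - 2 * of_real pi * \<i>"
  obtains \<epsilon> :: complex where "\<epsilon> \<noteq> 0"
    "\<And>t. \<exists>K. (\<forall>j. c * of_real (edge_vector vs j \<bullet> t) * K j
               = of_real (fst (edge_vector vs j)) * (plane_wave t (vertex vs (Suc j)) - plane_wave t (vertex vs j)))
         \<and> c * of_real (snd t) * fourier (indicator (polygonal_region vs)) t = \<epsilon> * (\<Sum>j<length vs. K j)"
proof -
  let ?P = "polygonal_region vs" and ?n = "length vs"
  have ne: "vs \<noteq> []" using vs by (auto simp: simple_polygon_def)
  obtain \<epsilon> :: real where eps: "\<epsilon> \<in> {1, - 1}"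
    and cross: "\<And>z. z \<notin> boundary_curve vs \<Longrightarrow> (\<And>j. fst (vertex vs j) \<noteq> fst z) \<Longrightarrow>
       \<epsilon> * indicator ?P z = (\<Sum>j<?n. crossing (vertex vs j) (vertex vs (Suc j)) z)"
    using indicator_region_eq_crossings[OF vs(1)] by blast
  have vsq: "vertex vs j \<in> unit_square" for j
    using vertex_in_set[OF ne] vs(2) by blast
  \<comment> \<open>The exceptional points lie on the boundary curve or on one of the finitely many
    vertical lines through vertices.\<close>
  have ae: "AE z in lborel. \<epsilon> * indicator ?P z = (\<Sum>j<?n. crossing (vertex vs j) (vertex vs (Suc j)) z)"
  proof -
    have "negligible (\<Union>v\<in>set vs. {z::point. (1, 0) \<bullet> z = fst v})"
      by (intro negligible_Union finite_imageI) (auto intro!: negligible_hyperplane simp: zero_prod_def)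
    from AE_not_negligible[OF this] AE_not_negligible[OF negligible_boundary_curve[OF vs(1)]]
    show ?thesis
    proof eventually_elim
      case (elim z)
      have "fst (vertex vs j) \<noteq> fst z" for j
        using elim(1) vertex_in_set[OF ne, of j] by (cases z) auto
      then show ?case using cross elim(2) by blast
    qed
  qed
  have "\<exists>K. (\<forall>j. c * of_real (edge_vector vs j \<bullet> t) * K j
               = of_real (fst (edge_vector vs j)) * (plane_wave t (vertex vs (Suc j)) - plane_wave t (vertex vs j)))
         \<and> c * of_real (snd t) * fourier (indicator ?P) t = of_real (- \<epsilon>) * (\<Sum>j<?n. K j)" for t
  proof -
    obtain \<Phi> where \<Phi>: "\<And>x S. (\<Phi> has_vector_derivative plane_wave t (x, 1)) (at x within S)"
      using plane_wave_top_antiderivative[of t] by blast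
    define I where "I = (\<lambda>j. edge_integral t (vertex vs j) (vertex vs (Suc j)))"
    define f where "f = (\<lambda>z. c * of_real (snd t) * plane_wave t z)"
    define K where "K = (\<lambda>j. \<Phi> (fst (vertex vs (Suc j))) - \<Phi> (fst (vertex vs j)) - I j)"
    note ei = edge_integral[OF vsq vsq \<Phi>, folded c_def]
    have int: "integrable lborel (\<lambda>z. (crossing (vertex vs j) (vertex vs (Suc j)) z * indicator {z. snd z < 1} z) *\<^sub>R f z)" for j
      using ei(1) by (simp add: f_def)
    have [measurable]: "f \<in> borel_measurable borel" unfolding f_def by measurable
    have "c * of_real (snd t) * fourier (indicator ?P) t = (LINT z|lborel. c * of_real (snd t) * (indicator ?P z * plane_wave t z))"
      unfolding fourier_def plane_wave_def by (rule integral_mult_right_zero[symmetric])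
    also have "\<dots> = (LINT z|lborel. indicator ?P z *\<^sub>R f z)"
      by (rule Bochner_Integration.integral_cong) (auto simp: f_def indicator_def)
    also have "\<dots> = (LINT z|lborel. \<epsilon> *\<^sub>R (\<Sum>j<?n. (crossing (vertex vs j) (vertex vs (Suc j)) z * indicator {z. snd z < 1} z) *\<^sub>R f z))"
    proof (rule integral_cong_AE)
      show "(\<lambda>z. \<epsilon> *\<^sub>R (\<Sum>j<?n. (crossing (vertex vs j) (vertex vs (Suc j)) z * indicator {z. snd z < 1} z) *\<^sub>R f z))
         \<in> borel_measurable lborel"
        using int by (intro borel_measurable_scaleR borel_measurable_sum borel_measurable_integrable) auto
      show "AE z in lborel. indicator ?P z *\<^sub>R f z = \<epsilon> *\<^sub>R (\<Sum>j<?n. (crossing (vertex vs j) (vertex vs (Suc j)) z * indicator {z. snd z < 1} z) *\<^sub>R f z)"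
        using ae
      proof eventually_elim
        case (elim z)
        have "(\<Sum>j<?n. (crossing (vertex vs j) (vertex vs (Suc j)) z * indicator {z. snd z < 1} z) *\<^sub>R f z)
          = (\<epsilon> * indicator ?P z * indicator {z. snd z < 1} z) *\<^sub>R f z"
          unfolding elim by (simp only: scaleR_sum_left sum_distrib_right)
        \<comment> \<open>The sign is its own inverse, which brings it to the other side of the
          crossing formula.\<close>
        moreover have "\<epsilon> * \<epsilon> = 1" using eps by auto
        moreover have "(indicator ?P z * indicator {z. snd z < 1} z :: real) = indicator ?P z"
          using sub by (auto simp: indicator_def unit_square_def)
        ultimately show ?case by (simp add: mult.assoc[symmetric])
      qed
    qed simp
    also have "\<dots> = \<epsilon> *\<^sub>R (\<Sum>j<?n. I j)"
      using int unfolding I_def edge_integral_def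
      by (subst integral_scaleR_right, subst Bochner_Integration.integral_sum) (auto simp: f_def c_def)
    \<comment> \<open>The contributions of the line \<open>y = 1\<close> telescope around the closed
      polygon, so only the integrals along the edges remain.\<close>
    also have "(\<Sum>j<?n. I j) = - (\<Sum>j<?n. K j)"
    proof -
      have "(\<Sum>j<?n. \<Phi> (fst (vertex vs (Suc j))) - \<Phi> (fst (vertex vs j))) = 0"
        by (simp add: sum_lessThan_telescope[of "\<lambda>j. \<Phi> (fst (vertex vs j))"])
      then show ?thesis by (simp add: K_def sum_subtractf)
    qed
    finally have "c * of_real (snd t) * fourier (indicator ?P) t = of_real (- \<epsilon>) * (\<Sum>j<?n. K j)"
      by (simp add: scaleR_conv_of_real)
    moreover have "c * of_real (edge_vector vs j \<bullet> t) * K j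
               = of_real (fst (edge_vector vs j)) * (plane_wave t (vertex vs (Suc j)) - plane_wave t (vertex vs j))" for j
      using ei(2)[of "Suc j" j] unfolding K_def I_def edge_vector_def fst_diff by simp
    ultimately show ?thesis by blast
  qed
  moreover have "complex_of_real (- \<epsilon>) \<noteq> 0" using eps by auto
  ultimately show ?thesis using that[of "complex_of_real (- \<epsilon>)"] by blast
qed

lemma norm_plane_wave [simp]: "norm (plane_wave t x) = 1"
proof -
  have "- 2 * of_real pi * \<i> * of_real (x \<bullet> t) = \<i> * complex_of_real (- 2 * pi * (x \<bullet> t))"
    by simp
  then show ?thesis unfolding plane_wave_def by (simp only: norm_exp_i_times)
qed

lemma tendsto_plane_wave [tendsto_intros]:
  "(u \<longlongrightarrow> t) F \<Longrightarrow> ((\<lambda>n. plane_wave (u n) x) \<longlongrightarrow> plane_wave t x) F"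
  unfolding plane_wave_def by (intro tendsto_intros)

text \<open>Dominated convergence, with the indicator itself as the bound. It serves to reach the
  frequencies on the axis, where the divergence formula for the vertical derivative is
  empty.\<close>

lemma tendsto_fourier_indicator:
  assumes P: "P \<in> sets borel" "P \<subseteq> unit_square" and u: "u \<longlonglongrightarrow> t"
  shows "(\<lambda>n. fourier (indicator P) (u n)) \<longlonglongrightarrow> fourier (indicator P) t"
proof -
  have [measurable]: "P \<in> sets lborel" using P by simp
  have "P \<subseteq> cbox (0, 0) (1, 1)"
    using P(2) by (force simp: unit_square_def cbox_Pair_eq)
  then have "emeasure lborel P \<le> emeasure lborel (cbox (0, 0) (1, 1 :: real) :: point set)"
    using P by (intro emeasure_mono) auto
  also have "\<dots> < \<infinity>" by (simp add: emeasure_lborel_cbox_eq)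
  finally have int: "integrable lborel (indicator P :: point \<Rightarrow> real)"
    using P by simp
  have "(\<lambda>n. LINT x|lborel. indicator P x * plane_wave (u n) x) \<longlonglongrightarrow> (LINT x|lborel. indicator P x * plane_wave t x)"
  proof (rule integral_dominated_convergence[OF _ _ int])
    show "AE x in lborel. (\<lambda>n. indicator P x * plane_wave (u n) x) \<longlonglongrightarrow> indicator P x * plane_wave t x"
      using u by (intro AE_I2 tendsto_intros)
    show "AE x in lborel. norm (indicator P x * plane_wave (u n) x) \<le> indicator P x" for n
      by (intro AE_I2) (auto simp: norm_mult indicator_def)
  qed auto
  then show ?thesis by (simp add: fourier_def plane_wave_def)
qed

section \<open>Polygons with edges in prescribed directions\<close>

locale directions =
  fixes k :: nat and s :: "nat \<Rightarrow> point"
  assumes not_parallel: "i \<in> {1..k} \<Longrightarrow> j \<in> {1..k} \<Longrightarrow> i \<noteq> j \<Longrightarrow> det2 (s i) (s j) \<noteq> 0"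
    and direction_nz: "i \<in> {1..k} \<Longrightarrow> s i \<noteq> 0"

locale directed_polygon = directions +
  fixes vs :: "point list"
  assumes simple: "simple_polygon vs"
    and vertices_sub: "set vs \<subseteq> unit_square"
    and region_sub: "polygonal_region vs \<subseteq> unit_square"
    and directed: "j < length vs \<Longrightarrow> \<exists>i\<in>{1..k}. parallel (edge_vector vs j) (s i)"
begin

abbreviation "n \<equiv> length vs"

text \<open>The choice depends on the edge vector alone, so \<open>dir\<close> inherits the period
  \<open>n\<close> of the edges.\<close>

definition dir :: "nat \<Rightarrow> nat" where
  "dir j = (SOME i. i \<in> {1..k} \<and> det2 (edge_vector vs j) (s i) = 0)"

text \<open>This belongs to the vertex \<open>vertex vs (Suc j)\<close>, where the edges
  \<open>j\<close> and \<open>Suc j\<close> meet; the linear forms of these two edges are left out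
  of the product.\<close>

definition vertex_weight :: "point \<Rightarrow> nat \<Rightarrow> real" where
  "vertex_weight t j = det2 (s (dir j)) (s (dir (Suc j))) * (\<Prod>i\<in>{1..k} - {dir j, dir (Suc j)}. s i \<bullet> t)"

lemma n_ge_3: "n \<ge> 3" and distinct_vs: "distinct vs" and vs_nonempty: "vs \<noteq> []"
  using simple by (auto simp: simple_polygon_def)

lemma edge_vector_mod [simp]: "edge_vector vs (j mod n) = edge_vector vs j"
  by (simp add: edge_vector_def vertex_def mod_Suc_eq)

lemma edge_vector_Suc_mod [simp]: "edge_vector vs (Suc (j mod n)) = edge_vector vs (Suc j)"
  by (simp add: edge_vector_def vertex_def mod_Suc_eq) (metis mod_Suc_eq)

lemma dir_cong: "edge_vector vs i = edge_vector vs j \<Longrightarrow> dir i = dir j"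
  by (simp add: dir_def)

lemma edge_not_parallel: "det2 (edge_vector vs j) (edge_vector vs (Suc j)) \<noteq> 0"
proof -
  have "j mod n < n" using n_ge_3 by (intro mod_less_divisor) linarith
  then have "\<not> parallel (edge_vector vs (j mod n)) (edge_vector vs (Suc (j mod n)))"
    using simple unfolding simple_polygon_def by blast
  then show ?thesis by (simp add: parallel_iff_det2)
qed

lemma edge_vector_nz: "edge_vector vs j \<noteq> 0"
  using edge_not_parallel[of j] by (auto simp: det2_def)

lemma dir: "dir j \<in> {1..k}" "det2 (edge_vector vs j) (s (dir j)) = 0"
proof -
  have "j mod n < n" using n_ge_3 by (intro mod_less_divisor) linarith
  from directed[OF this] have "\<exists>i. i \<in> {1..k} \<and> det2 (edge_vector vs j) (s i) = 0"
    by (auto simp: parallel_iff_det2)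
  from someI_ex[OF this] show "dir j \<in> {1..k}" "det2 (edge_vector vs j) (s (dir j)) = 0"
    by (simp_all add: dir_def)
qed

lemma edge_vector_multiple:
  obtains c where "c \<noteq> 0" "edge_vector vs j = c *\<^sub>R s (dir j)"
proof -
  obtain c where "edge_vector vs j = c *\<^sub>R s (dir j)"
    using det2_eq_0_imp_multiple[OF dir(2) direction_nz[OF dir(1)]] by blast
  then show ?thesis using that edge_vector_nz[of j] by auto
qed

lemma dir_Suc_neq: "dir j \<noteq> dir (Suc j)"
proof
  assume eq: "dir j = dir (Suc j)"
  obtain c d where "edge_vector vs j = c *\<^sub>R s (dir j)" "edge_vector vs (Suc j) = d *\<^sub>R s (dir (Suc j))"
    using edge_vector_multiple by metis
  then show False using edge_not_parallel[of j] eq by (simp add: det2_def)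
qed

lemma dir_length: "dir n = dir 0"
  by (rule dir_cong) (use edge_vector_mod[of n] in simp)

text \<open>Multiplying the flux through edge \<open>j\<close> by all linear forms cancels the form
  of that edge and leaves \<open>g j\<close> times a difference of vertex values. Summation by parts
  then puts \<open>g j - g (Suc j)\<close> at the common vertex of two edges, and this difference
  contains the factor \<open>snd t\<close>, which cancels against the one from the vertical
  derivative.\<close>

lemma fourier_polygon_offaxis:
  obtains \<epsilon> :: complex where "\<epsilon> \<noteq> 0"
    "\<And>t. snd t \<noteq> 0 \<Longrightarrow> of_real (\<Prod>i\<in>{1..k}. s i \<bullet> t) * fourier (indicator (polygonal_region vs)) t
        = \<epsilon> * (\<Sum>j<n. of_real (vertex_weight t j) * plane_wave t (vertex vs (Suc j)))"
proof -
  define c :: complex where "c = - 2 * of_real pi * \<i>"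
  have c: "c \<noteq> 0" by (simp add: c_def)
  obtain \<epsilon> where eps: "\<epsilon> \<noteq> 0" and ed:
    "\<And>t. \<exists>K. (\<forall>j. c * of_real (edge_vector vs j \<bullet> t) * K j
               = of_real (fst (edge_vector vs j)) * (plane_wave t (vertex vs (Suc j)) - plane_wave t (vertex vs j)))
         \<and> c * of_real (snd t) * fourier (indicator (polygonal_region vs)) t = \<epsilon> * (\<Sum>j<n. K j)"
    using fourier_polygon_edges[OF simple vertices_sub region_sub, folded c_def] by blast
  have "of_real (\<Prod>i\<in>{1..k}. s i \<bullet> t) * fourier (indicator (polygonal_region vs)) t
        = \<epsilon> / c\<^sup>2 * (\<Sum>j<n. of_real (vertex_weight t j) * plane_wave t (vertex vs (Suc j)))"
    if t: "snd t \<noteq> 0" for t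
  proof -
    let ?W = "\<lambda>j. plane_wave t (vertex vs j)"
    define D where "D = (\<Prod>i\<in>{1..k}. s i \<bullet> t)"
    define g where "g = (\<lambda>j. fst (s (dir j)) * (\<Prod>i\<in>{1..k} - {dir j}. s i \<bullet> t))"
    obtain K where K: "\<And>j. c * of_real (edge_vector vs j \<bullet> t) * K j
               = of_real (fst (edge_vector vs j)) * (?W (Suc j) - ?W j)"
      and F: "c * of_real (snd t) * fourier (indicator (polygonal_region vs)) t = \<epsilon> * (\<Sum>j<n. K j)"
      using ed[of t] by blast
    have Kdir: "c * of_real D * K j = of_real (g j) * (?W (Suc j) - ?W j)" for j
    proof -
      obtain r where r: "r \<noteq> 0" "edge_vector vs j = r *\<^sub>R s (dir j)" using edge_vector_multiple .
      have "of_real r * (c * of_real (s (dir j) \<bullet> t) * K j) = of_real r * (of_real (fst (s (dir j))) * (?W (Suc j) - ?W j))"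
        using K[of j] unfolding r by (simp add: mult_ac)
      then have "c * of_real (s (dir j) \<bullet> t) * K j = of_real (fst (s (dir j))) * (?W (Suc j) - ?W j)"
        using r(1) by simp
      moreover have "D = (s (dir j) \<bullet> t) * (\<Prod>i\<in>{1..k} - {dir j}. s i \<bullet> t)"
        unfolding D_def using dir(1) by (intro prod.remove) auto
      ultimately show ?thesis by (simp add: g_def mult_ac)
    qed
    have gw: "g j - g (Suc j) = snd t * vertex_weight t j" for j
    proof -
      let ?a = "dir j" and ?b = "dir (Suc j)"
      have 1: "(\<Prod>i\<in>{1..k} - {?a}. s i \<bullet> t) = (s ?b \<bullet> t) * (\<Prod>i\<in>{1..k} - {?a, ?b}. s i \<bullet> t)"
        using dir(1)[of "Suc j"] dir_Suc_neq[of j]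
        by (subst prod.remove[of _ ?b]) (auto intro!: arg_cong[where f = "prod _"])
      have 2: "(\<Prod>i\<in>{1..k} - {?b}. s i \<bullet> t) = (s ?a \<bullet> t) * (\<Prod>i\<in>{1..k} - {?a, ?b}. s i \<bullet> t)"
        using dir(1)[of j] dir_Suc_neq[of j]
        by (subst prod.remove[of _ ?a]) (auto intro!: arg_cong[where f = "prod _"])
      \<comment> \<open>The two products share all forms but one each, so the difference reduces to
        this identity; it brings in the determinant and the factor \<open>snd t\<close>.\<close>
      have 3: "fst (s ?a) * (s ?b \<bullet> t) - fst (s ?b) * (s ?a \<bullet> t) = snd t * det2 (s ?a) (s ?b)"
        by (cases t; cases "s ?a"; cases "s ?b") (simp add: det2_def algebra_simps)
      show ?thesis
        unfolding g_def 1 2 vertex_weight_def mult.assoc[symmetric] 3[symmetric]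
        by (simp add: algebra_simps)
    qed
    have gn: "g n = g 0" by (simp add: g_def dir_length)
    have "c\<^sup>2 * of_real (snd t) * (of_real D * fourier (indicator (polygonal_region vs)) t)
       = c * of_real D * (c * of_real (snd t) * fourier (indicator (polygonal_region vs)) t)"
      by (simp add: power2_eq_square mult_ac)
    also have "\<dots> = \<epsilon> * (\<Sum>j<n. c * of_real D * K j)"
      unfolding F by (simp add: sum_distrib_left mult_ac)
    also have "(\<Sum>j<n. c * of_real D * K j) = (\<Sum>j<n. of_real (g j) * ?W (Suc j)) - (\<Sum>j<n. of_real (g j) * ?W j)"
      unfolding Kdir by (simp add: right_diff_distrib sum_subtractf)
    \<comment> \<open>Shifting the index is allowed because both \<open>g\<close> and the vertices
      close up after \<open>n\<close> steps.\<close>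
    also have "(\<Sum>j<n. of_real (g j) * ?W j) = (\<Sum>j<n. of_real (g (Suc j)) * ?W (Suc j))"
    proof -
      have "(\<Sum>j<n. of_real (g (Suc j)) * ?W (Suc j)) - (\<Sum>j<n. of_real (g j) * ?W j) = 0"
        using sum_lessThan_telescope[of "\<lambda>j. of_real (g j) * ?W j" n] gn by (simp add: sum_subtractf)
      then show ?thesis by simp
    qed
    also have "(\<Sum>j<n. of_real (g j) * ?W (Suc j)) - (\<Sum>j<n. of_real (g (Suc j)) * ?W (Suc j))
       = (\<Sum>j<n. of_real (g j - g (Suc j)) * ?W (Suc j))"
      by (simp add: sum_subtractf left_diff_distrib)
    also have "\<dots> = of_real (snd t) * (\<Sum>j<n. of_real (vertex_weight t j) * ?W (Suc j))"
      unfolding gw by (simp add: sum_distrib_left mult_ac)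
    finally show ?thesis using t c by (simp add: D_def field_simps)
  qed
  then show ?thesis using that[of "\<epsilon> / c\<^sup>2"] eps c by auto
qed

text \<open>Both sides are continuous in \<open>t\<close>, so the formula extends to the axis
  \<open>snd t = 0\<close>.\<close>

lemma fourier_polygon:
  obtains \<epsilon> :: complex where "\<epsilon> \<noteq> 0"
    "\<And>t. of_real (\<Prod>i\<in>{1..k}. s i \<bullet> t) * fourier (indicator (polygonal_region vs)) t
        = \<epsilon> * (\<Sum>j<n. of_real (vertex_weight t j) * plane_wave t (vertex vs (Suc j)))"
proof -
  obtain \<epsilon> :: complex where eps: "\<epsilon> \<noteq> 0" and off:
    "\<And>t. snd t \<noteq> 0 \<Longrightarrow> of_real (\<Prod>i\<in>{1..k}. s i \<bullet> t) * fourier (indicator (polygonal_region vs)) t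
        = \<epsilon> * (\<Sum>j<n. of_real (vertex_weight t j) * plane_wave t (vertex vs (Suc j)))"
    using fourier_polygon_offaxis by blast
  have "of_real (\<Prod>i\<in>{1..k}. s i \<bullet> t) * fourier (indicator (polygonal_region vs)) t
        = \<epsilon> * (\<Sum>j<n. of_real (vertex_weight t j) * plane_wave t (vertex vs (Suc j)))"
    (is "?L t = ?R t") if "snd t = 0" for t
  proof -
    define u where "u = (\<lambda>m. (fst t, inverse (real (Suc m))))"
    have u: "u \<longlonglongrightarrow> t"
      using tendsto_Pair[OF tendsto_const LIMSEQ_inverse_real_of_nat, of "fst t"] that
      by (simp add: u_def prod_eq_iff[of _ t]) (metis prod.collapse)
    have "(\<lambda>m. ?L (u m)) \<longlonglongrightarrow> ?L t"
      using u by (intro tendsto_intros tendsto_fourier_indicator region_sub polygonal_region_borel)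
    moreover have "(\<lambda>m. ?R (u m)) \<longlonglongrightarrow> ?R t"
      unfolding vertex_weight_def using u by (intro tendsto_intros)
    moreover have "?L (u m) = ?R (u m)" for m
      by (rule off) (simp add: u_def)
    ultimately show ?thesis using LIMSEQ_unique by simp
  qed
  then show ?thesis using that eps off by blast
qed

end

section \<open>Exponential polynomials\<close>

lemma poly_zero_on_nat:
  fixes p :: "'a::field_char_0 poly"
  assumes "\<And>m::nat. poly p (of_nat m) = 0"
  shows "p = 0"
proof (rule ccontr)
  assume "p \<noteq> 0"
  then have "finite {x. poly p x = 0}" by (rule poly_roots_finite)
  moreover have "range (of_nat :: nat \<Rightarrow> 'a) \<subseteq> {x. poly p x = 0}" using assms by auto
  ultimately have "finite (range (of_nat :: nat \<Rightarrow> 'a))" by (rule finite_subset[rotated])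
  then show False using range_inj_infinite[OF inj_of_nat] by blast
qed

text \<open>The operator \<open>E - w\<close>, with \<open>E\<close> the shift, turns the sequence
  \<open>q(m) z^m\<close> into \<open>q'(m) z^m\<close>. For \<open>z = w\<close> the leading terms
  cancel; for \<open>z \<noteq> w\<close> the leading coefficient survives up to a nonzero
  factor.\<close>

lemma shift_poly:
  fixes q :: "'a::field_char_0 poly" and z w :: 'a
  defines "q' \<equiv> smult z (pcompose q [:1, 1:]) - smult w q"
  shows "degree q' \<le> degree q" "coeff q' (degree q) = (z - w) * lead_coeff q"
    "poly q' x = z * poly q (x + 1) - w * poly q x"
proof -
  have deg: "degree (pcompose q [:1, 1:]) = degree q" by (simp add: degree_pcompose)
  show "degree q' \<le> degree q"
    unfolding q'_def by (intro degree_diff_le order_trans[OF degree_smult_le]) (auto simp: deg)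
  have "lead_coeff (pcompose q [:1, 1:]) = lead_coeff q" by (subst lead_coeff_comp) auto
  then have "coeff (pcompose q [:1, 1:]) (degree q) = lead_coeff q" by (simp only: deg)
  then show "coeff q' (degree q) = (z - w) * lead_coeff q"
    by (simp add: q'_def algebra_simps)
  show "poly q' x = z * poly q (x + 1) - w * poly q x"
    by (simp add: q'_def poly_pcompose add.commute)
qed

text \<open>Induction on the total multiplicity: the operator \<open>E - w\<close>, with \<open>E\<close> the shift, lowers the
  multiplicity of the node \<open>w\<close> and preserves the degrees of the other coefficients.\<close>

lemma exponential_polynomial_eq_0:
  fixes q :: "'a::field_char_0 \<Rightarrow> 'a poly"
  assumes "finite Z" "0 \<notin> Z"
    and "\<And>z. z \<in> Z \<Longrightarrow> q z = 0 \<or> degree (q z) < d z"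
    and "\<And>m. m < sum d Z \<Longrightarrow> (\<Sum>z\<in>Z. poly (q z) (of_nat m) * z ^ m) = 0"
    and "z \<in> Z"
  shows "q z = 0"
  using assms
proof (induction "sum d Z" arbitrary: q d z)
  case 0
  then show ?case by auto
next
  case (Suc N)
  obtain w where w: "w \<in> Z" "d w > 0"
    using Suc.hyps(2) by (metis gr0I nat.distinct(1) sum.neutral)
  define d' where "d' = d(w := d w - 1)"
  define q' where "q' = (\<lambda>z. smult z (pcompose (q z) [:1, 1:]) - smult w (q z))"
  have N: "N = sum d' Z"
  proof -
    have "sum d' Z = d' w + sum d' (Z - {w})" "sum d Z = d w + sum d (Z - {w})"
      using w Suc.prems(1) by (simp_all add: sum.remove)
    moreover have "sum d' (Z - {w}) = sum d (Z - {w})" by (rule sum.cong) (auto simp: d'_def)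
    ultimately show ?thesis using Suc.hyps(2) w(2) by (simp add: d'_def)
  qed
  have q'0: "q' z = 0" if z: "z \<in> Z" for z
  proof (rule Suc.hyps(1)[OF N Suc.prems(1,2) _ _ z])
    fix z assume z: "z \<in> Z"
    show "q' z = 0 \<or> degree (q' z) < d' z"
    proof (cases "q z = 0")
      case True
      then show ?thesis by (simp add: q'_def)
    next
      case False
      then have dz: "degree (q z) < d z" using Suc.prems(3) z by blast
      show ?thesis
      proof (cases "z = w")
        case True
        have "q' z = 0 \<or> degree (q' z) < degree (q z)"
          using shift_poly(1,2)[of z "q z" w] True unfolding q'_def
          by (intro eq_zero_or_degree_less) auto
        then show ?thesis using dz True by (auto simp: d'_def)
      next
        case False
        then show ?thesis using shift_poly(1)[of z "q z" w] dz by (simp add: q'_def d'_def)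
      qed
    qed
  next
    fix m assume m: "m < sum d' Z"
    \<comment> \<open>The new sequence at \<open>m\<close> involves the old one at \<open>m\<close>
      and \<open>Suc m\<close>. One equation is lost, just as the total multiplicity drops by
      one.\<close>
    have "(\<Sum>z\<in>Z. poly (q' z) (of_nat m) * z ^ m)
       = (\<Sum>z\<in>Z. poly (q z) (of_nat (Suc m)) * z ^ Suc m) - w * (\<Sum>z\<in>Z. poly (q z) (of_nat m) * z ^ m)"
      unfolding q'_def shift_poly(3) sum_distrib_left sum_subtractf[symmetric]
      by (rule sum.cong) (auto simp: algebra_simps)
    also have "\<dots> = 0" using Suc.prems(4)[of m] Suc.prems(4)[of "Suc m"] m N Suc.hyps(2) by simp
    finally show "(\<Sum>z\<in>Z. poly (q' z) (of_nat m) * z ^ m) = 0" .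
  qed
  have other: "q z = 0" if "z \<in> Z" "z \<noteq> w" for z
  proof -
    have "(z - w) * lead_coeff (q z) = coeff (q' z) (degree (q z))"
      unfolding q'_def by (rule shift_poly(2)[symmetric])
    then show ?thesis using q'0[OF that(1)] that(2) by simp
  qed
  have w0: "w \<noteq> 0" using w(1) Suc.prems(2) by blast
  \<comment> \<open>Only the node \<open>w\<close> is left. Here \<open>q' w = 0\<close> makes
    \<open>q w\<close> constant on the natural numbers, and the equation for \<open>m = 0\<close>
    gives the constant.\<close>
  have "poly (q w) (of_nat m) = 0" for m
  proof (induction m)
    case 0
    have "(\<Sum>z\<in>Z. poly (q z) (of_nat 0) * z ^ 0) = 0" using Suc.prems(4)[of 0] Suc.hyps(2) by simp
    also have "(\<Sum>z\<in>Z. poly (q z) (of_nat 0) * z ^ 0) = poly (q w) (of_nat 0) * w ^ 0"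
      using w(1) Suc.prems(1) other by (subst sum.remove[of _ w]) (auto intro!: sum.neutral)
    finally show ?case by simp
  next
    case (Suc m)
    have "w * poly (q w) (of_nat m + 1) - w * poly (q w) (of_nat m) = 0"
    proof -
      have "poly (q' w) (of_nat m) = w * poly (q w) (of_nat m + 1) - w * poly (q w) (of_nat m)"
        unfolding q'_def by (rule shift_poly(3))
      then show ?thesis using q'0[OF w(1)] by simp
    qed
    then show ?case using Suc.IH w0 by (simp add: add.commute)
  qed
  then have "q w = 0" by (rule poly_zero_on_nat)
  then show ?case using other Suc.prems(5) by blast
qed

section \<open>Exponential polynomials in two variables\<close>

text \<open>Columns (nodes with the same first coordinate) are treated in the order of increasing size:
  once those with at most \<open>r\<close> nodes are gone, at most \<open>card V div (r + 1)\<close> columns remain.\<close>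

lemma exponential_polynomial_2d_eq_0:
  fixes c :: "'a::field_char_0 \<times> 'a \<Rightarrow> nat \<Rightarrow> 'a poly"
  assumes V: "finite V" "\<And>v. v \<in> V \<Longrightarrow> fst v \<noteq> 0 \<and> snd v \<noteq> 0"
    and deg: "\<And>v i. v \<in> V \<Longrightarrow> i < d \<Longrightarrow> degree (c v i) < d"
    and zero: "\<And>r m n. 1 \<le> r \<Longrightarrow> r \<le> card V \<Longrightarrow> m < card V div r * d \<Longrightarrow> n < r * d \<Longrightarrow>
       (\<Sum>v\<in>V. (\<Sum>i<d. poly (c v i) (of_nat n) * of_nat m ^ i) * fst v ^ m * snd v ^ n) = 0"
    and v: "v \<in> V" "i < d"
  shows "c v i = 0"
proof -
  define col where "col = (\<lambda>x. {v \<in> V. fst v = x})"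
  have fcol: "finite (col x)" for x using V(1) by (simp add: col_def)
  have "\<forall>v\<in>V. card (col (fst v)) \<le> r \<longrightarrow> (\<forall>i<d. c v i = 0)" for r
  proof (induction r)
    case 0
    have "card (col (fst v)) \<noteq> 0" if "v \<in> V" for v
    proof -
      have "v \<in> col (fst v)" using that by (simp add: col_def)
      then show ?thesis using fcol by (metis card_0_eq empty_iff)
    qed
    then show ?case by (metis le_zero_eq)
  next
    case (Suc r)
    define B where "B = {x \<in> fst ` V. Suc r \<le> card (col x)}"
    have B: "finite B" using V(1) by (simp add: B_def)
    have "card B * Suc r \<le> (\<Sum>x\<in>B. card (col x))"
      using sum_bounded_below[of B "Suc r" "\<lambda>x. card (col x)"] by (simp add: B_def)
    also have "\<dots> = card (\<Union>x\<in>B. col x)"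
      using B fcol by (intro card_UN_disjoint[symmetric]) (auto simp: col_def)
    also have "\<dots> \<le> card V" using V(1) by (intro card_mono) (auto simp: col_def)
    finally have cB: "card B \<le> card V div Suc r" by (simp add: less_eq_div_iff_mult_less_eq)
    show ?case
    proof (intro ballI impI)
      fix v0 assume v0: "v0 \<in> V" "card (col (fst v0)) \<le> Suc r"
      show "\<forall>i<d. c v0 i = 0"
      proof (cases "card (col (fst v0)) \<le> r")
        case True
        then show ?thesis using Suc.IH v0(1) by blast
      next
        case False
        then have card0: "card (col (fst v0)) = Suc r" using v0(2) by simp
        have xB: "fst v0 \<in> B" using v0 card0 by (simp add: B_def)
        have r: "Suc r \<le> card V"
          using card0 card_mono[OF V(1), of "col (fst v0)"] by (auto simp: col_def)
        \<comment> \<open>For fixed \<open>n\<close> the sum is an exponential polynomial in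
          \<open>m\<close> whose nodes are the remaining columns; \<open>Q x\<close> below is the
          coefficient of column \<open>x\<close>, as a polynomial in \<open>m\<close>.\<close>
        have col0: "(\<Sum>v\<in>col (fst v0). poly (c v i) (of_nat n) * snd v ^ n) = 0"
          if n: "n < Suc r * d" and i: "i < d" for n i
        proof -
          define Q where "Q = (\<lambda>x. \<Sum>v\<in>col x. \<Sum>i<d. monom (poly (c v i) (of_nat n) * snd v ^ n) i)"
          have coeffQ: "coeff (Q x) i = (if i < d then \<Sum>v\<in>col x. poly (c v i) (of_nat n) * snd v ^ n else 0)" for x i
          proof -
            have "coeff (Q x) i = (\<Sum>v\<in>col x. \<Sum>l<d. if l = i then poly (c v l) (of_nat n) * snd v ^ n else 0)"
              by (simp add: Q_def coeff_sum)
            also have "\<dots> = (if i < d then \<Sum>v\<in>col x. poly (c v i) (of_nat n) * snd v ^ n else 0)"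
              by (simp add: sum.delta)
            finally show ?thesis .
          qed
          have "Q (fst v0) = 0"
          proof (rule exponential_polynomial_eq_0[where d = "\<lambda>_. d", OF B _ _ _ xB])
            show "0 \<notin> B" using V(2) by (auto simp: B_def)
            show "Q x = 0 \<or> degree (Q x) < d" for x
              using i by (intro disjI2 degree_lessI) (auto simp: coeffQ)
            fix m assume "m < (\<Sum>z\<in>B. d)"
            then have "m < card B * d" by simp
            also have "\<dots> \<le> card V div Suc r * d" by (rule mult_le_mono1[OF cB])
            finally have m: "m < card V div Suc r * d" .
            have "(\<Sum>x\<in>B. poly (Q x) (of_nat m) * x ^ m)
              = (\<Sum>x\<in>B. \<Sum>v\<in>col x. (\<Sum>i<d. poly (c v i) (of_nat n) * of_nat m ^ i) * fst v ^ m * snd v ^ n)"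
            proof (rule sum.cong[OF refl])
              fix x assume "x \<in> B"
              show "poly (Q x) (of_nat m) * x ^ m
                = (\<Sum>v\<in>col x. (\<Sum>i<d. poly (c v i) (of_nat n) * of_nat m ^ i) * fst v ^ m * snd v ^ n)"
                unfolding Q_def poly_sum sum_distrib_right
                by (intro sum.cong refl) (auto simp: col_def poly_monom mult_ac)
            qed
            also have "\<dots> = (\<Sum>v\<in>(\<Union>x\<in>B. col x). (\<Sum>i<d. poly (c v i) (of_nat n) * of_nat m ^ i) * fst v ^ m * snd v ^ n)"
              using B fcol by (intro sum.UNION_disjoint[symmetric]) (auto simp: col_def)
            also have "\<dots> = (\<Sum>v\<in>V. (\<Sum>i<d. poly (c v i) (of_nat n) * of_nat m ^ i) * fst v ^ m * snd v ^ n)"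
            proof (rule sum.mono_neutral_left[OF V(1)])
              show "(\<Union>x\<in>B. col x) \<subseteq> V" by (auto simp: col_def)
              have "c v i = 0" if "v \<in> V" "v \<notin> (\<Union>x\<in>B. col x)" "i < d" for v i
              proof -
                have "card (col (fst v)) \<le> r"
                  using that by (auto simp: B_def col_def not_less_eq_eq)
                then show ?thesis using Suc.IH that by blast
              qed
              then show "\<forall>v\<in>V - (\<Union>x\<in>B. col x).
                (\<Sum>i<d. poly (c v i) (of_nat n) * of_nat m ^ i) * fst v ^ m * snd v ^ n = 0"
                by (auto intro!: sum.neutral)
            qed
            also have "\<dots> = 0" using zero[OF _ r m n] by simp
            finally show "(\<Sum>x\<in>B. poly (Q x) (of_nat m) * x ^ m) = 0" .
          qed
          then show ?thesis using coeffQ[of "fst v0" i] i by simp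
        qed
        show ?thesis
        proof (intro allI impI)
          fix i assume i: "i < d"
          \<comment> \<open>Now \<open>i\<close> is fixed and \<open>n\<close> varies: within the
            column the second coordinates are \<open>Suc r\<close> distinct nodes, so the lemma in
            one variable applies again.\<close>
          have inj: "inj_on snd (col (fst v0))" by (auto simp: col_def inj_on_def prod_eq_iff)
          define q where "q = (\<lambda>y. c (fst v0, y) i)"
          have qv: "c v i = q (snd v)" if "v \<in> col (fst v0)" for v
            using that unfolding q_def col_def by (metis (mono_tags) mem_Collect_eq prod.collapse)
          have "q (snd v0) = 0"
          proof (rule exponential_polynomial_eq_0[where d = "\<lambda>_. d" and Z = "snd ` col (fst v0)"])
            show "finite (snd ` col (fst v0))" using fcol by blast
            show "0 \<notin> snd ` col (fst v0)" using V(2) by (auto simp: col_def)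
            show "snd v0 \<in> snd ` col (fst v0)" using v0(1) by (auto simp: col_def)
            show "q z = 0 \<or> degree (q z) < d" if "z \<in> snd ` col (fst v0)" for z
              using that deg i by (auto simp: q_def col_def)
            fix m assume "m < (\<Sum>z\<in>snd ` col (fst v0). d)"
            then have m: "m < Suc r * d" by (simp add: card_image[OF inj] card0)
            have "(\<Sum>z\<in>snd ` col (fst v0). poly (q z) (of_nat m) * z ^ m)
               = (\<Sum>v\<in>col (fst v0). poly (c v i) (of_nat m) * snd v ^ m)"
              by (subst sum.reindex[OF inj]) (simp add: qv)
            then show "(\<Sum>z\<in>snd ` col (fst v0). poly (q z) (of_nat m) * z ^ m) = 0"
              using col0[OF m i] by simp
          qed
          then show "c v0 i = 0" by (simp add: q_def)
        qed
      qed
    qed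
  qed
  then show ?thesis using v by blast
qed

section \<open>Polynomial functions of two variables\<close>

text \<open>The degree is at most \<open>D\<close> in each variable separately; the function is a
  polynomial in \<open>x\<close> whose coefficients are polynomials in \<open>y\<close>. Requiring
  the coefficients beyond \<open>D\<close> to be zero lets the sum be extended by one term when the
  degree grows.\<close>

definition bipoly :: "nat \<Rightarrow> ('a::field_char_0 \<Rightarrow> 'a \<Rightarrow> 'a) \<Rightarrow> bool" where
  "bipoly D F \<longleftrightarrow> (\<exists>c. (\<forall>i. degree (c i) \<le> D) \<and> (\<forall>i>D. c i = 0) \<and>
     (\<forall>x y. F x y = (\<Sum>i\<le>D. poly (c i) y * x ^ i)))"

lemma bipoly_const: "bipoly 0 (\<lambda>_ _. a)"
  unfolding bipoly_def by (intro exI[of _ "\<lambda>i. if i = 0 then [:a:] else 0"]) auto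

lemma bipoly_zero: "bipoly D (\<lambda>_ _. 0)"
  unfolding bipoly_def by (intro exI[of _ "\<lambda>_. 0"]) auto

lemma bipoly_add:
  assumes "bipoly D F" "bipoly D G"
  shows "bipoly D (\<lambda>x y. F x y + G x y)"
proof -
  obtain c e where "\<forall>i. degree (c i) \<le> D" "\<forall>i>D. c i = 0" "\<forall>x y. F x y = (\<Sum>i\<le>D. poly (c i) y * x ^ i)"
    "\<forall>i. degree (e i) \<le> D" "\<forall>i>D. e i = 0" "\<forall>x y. G x y = (\<Sum>i\<le>D. poly (e i) y * x ^ i)"
    using assms unfolding bipoly_def by blast
  then show ?thesis
    unfolding bipoly_def
    by (intro exI[of _ "\<lambda>i. c i + e i"]) (auto intro: degree_add_le simp: sum.distrib distrib_right)
qed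

lemma bipoly_sum: "(\<And>j. j \<in> J \<Longrightarrow> bipoly D (F j)) \<Longrightarrow> bipoly D (\<lambda>x y. \<Sum>j\<in>J. F j x y)"
  by (induction J rule: infinite_finite_induct) (auto intro: bipoly_add bipoly_zero)

lemma bipoly_scale:
  assumes "bipoly D F" shows "bipoly D (\<lambda>x y. a * F x y)"
proof -
  obtain c where "\<forall>i. degree (c i) \<le> D" "\<forall>i>D. c i = 0" "\<forall>x y. F x y = (\<Sum>i\<le>D. poly (c i) y * x ^ i)"
    using assms unfolding bipoly_def by blast
  then show ?thesis
    unfolding bipoly_def
    by (intro exI[of _ "\<lambda>i. smult a (c i)"])
       (auto intro: order_trans[OF degree_smult_le] simp: sum_distrib_left mult.assoc)
qed

lemma bipoly_linear:
  assumes "bipoly D F" shows "bipoly (Suc D) (\<lambda>x y. (a * x + b * y) * F x y)"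
proof -
  obtain c where c: "\<And>i. degree (c i) \<le> D" "\<And>i. i > D \<Longrightarrow> c i = 0" "\<And>x y. F x y = (\<Sum>i\<le>D. poly (c i) y * x ^ i)"
    using assms unfolding bipoly_def by blast
  \<comment> \<open>Multiplication by \<open>x\<close> shifts the coefficients, and multiplication
    by \<open>y\<close> multiplies each of them by a linear polynomial.\<close>
  define e where "e = (\<lambda>i. (case i of 0 \<Rightarrow> 0 | Suc l \<Rightarrow> smult a (c l)) + [:0, b:] * c i)"
  have "degree (e i) \<le> Suc D" for i
  proof -
    have "degree (case i of 0 \<Rightarrow> 0 | Suc l \<Rightarrow> smult a (c l)) \<le> Suc D"
      by (auto split: nat.split intro: order_trans[OF degree_smult_le] le_SucI[OF c(1)])
    moreover have "degree ([:0, b:] * c i) \<le> Suc D"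
      using degree_mult_le[of "[:0, b:]" "c i"] c(1)[of i] by (simp split: if_splits)
    ultimately show ?thesis unfolding e_def by (rule degree_add_le)
  qed
  moreover have "e i = 0" if "i > Suc D" for i
    using that c(2) by (auto simp: e_def split: nat.split)
  moreover have "(a * x + b * y) * F x y = (\<Sum>i\<le>Suc D. poly (e i) y * x ^ i)" for x y
  proof -
    have "(\<Sum>i\<le>Suc D. poly (e i) y * x ^ i)
      = (\<Sum>i\<le>Suc D. poly (case i of 0 \<Rightarrow> 0 | Suc l \<Rightarrow> smult a (c l)) y * x ^ i)
      + (\<Sum>i\<le>Suc D. b * y * poly (c i) y * x ^ i)"
      by (simp only: e_def sum.distrib[symmetric]) (simp add: algebra_simps)
    also have "(\<Sum>i\<le>Suc D. poly (case i of 0 \<Rightarrow> 0 | Suc l \<Rightarrow> smult a (c l)) y * x ^ i) = a * x * F x y"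
      by (subst sum.atMost_Suc_shift) (simp add: c(3) sum_distrib_left mult_ac)
    also have "(\<Sum>i\<le>Suc D. b * y * poly (c i) y * x ^ i) = b * y * F x y"
      by (simp add: c sum_distrib_left mult_ac)
    finally show ?thesis by (simp add: algebra_simps)
  qed
  ultimately show ?thesis unfolding bipoly_def by blast
qed

lemma bipoly_prod:
  assumes "finite I" shows "bipoly (card I) (\<lambda>x y. \<Prod>i\<in>I. a i * x + b i * y)"
  using assms by (induction I) (auto intro: bipoly_const bipoly_linear)

text \<open>Degree at most \<open>D\<close> in each variable gives every node the multiplicity
  \<open>Suc D\<close>, both across the columns and inside a column.\<close>

lemma exponential_bipoly_eq_0:
  fixes F :: "'a::field_char_0 \<times> 'a \<Rightarrow> 'a \<Rightarrow> 'a \<Rightarrow> 'a"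
  assumes V: "finite V" "\<And>v. v \<in> V \<Longrightarrow> fst v \<noteq> 0 \<and> snd v \<noteq> 0"
    and F: "\<And>v. v \<in> V \<Longrightarrow> bipoly D (F v)"
    and zero: "\<And>r m n. 1 \<le> r \<Longrightarrow> r \<le> card V \<Longrightarrow> m < card V div r * Suc D \<Longrightarrow> n < r * Suc D \<Longrightarrow>
       (\<Sum>v\<in>V. F v (of_nat m) (of_nat n) * fst v ^ m * snd v ^ n) = 0"
    and v: "v \<in> V"
  shows "F v x y = 0"
proof -
  obtain c where c: "\<And>v i. v \<in> V \<Longrightarrow> degree (c v i) \<le> D"
    "\<And>v x y. v \<in> V \<Longrightarrow> F v x y = (\<Sum>i\<le>D. poly (c v i) y * x ^ i)"
    using bchoice[of V "\<lambda>v c. (\<forall>i. degree (c i) \<le> D) \<and> (\<forall>i>D. c i = 0) \<and>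
     (\<forall>x y. F v x y = (\<Sum>i\<le>D. poly (c i) y * x ^ i))"] F unfolding bipoly_def by blast
  have "c v i = 0" if "i < Suc D" for i
  proof (rule exponential_polynomial_2d_eq_0[where d = "Suc D", OF V _ _ v that])
    show "degree (c u i) < Suc D" if "u \<in> V" for u i
      using c(1)[OF that] by (simp add: less_Suc_eq_le)
    fix r m n assume *: "1 \<le> r" "r \<le> card V" "m < card V div r * Suc D" "n < r * Suc D"
    have "(\<Sum>v\<in>V. (\<Sum>i<Suc D. poly (c v i) (of_nat n) * of_nat m ^ i) * fst v ^ m * snd v ^ n)
        = (\<Sum>v\<in>V. F v (of_nat m) (of_nat n) * fst v ^ m * snd v ^ n)"
      by (rule sum.cong) (auto simp: c(2) lessThan_Suc_atMost)
    then show "(\<Sum>v\<in>V. (\<Sum>i<Suc D. poly (c v i) (of_nat n) * of_nat m ^ i) * fst v ^ m * snd v ^ n) = 0"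
      using zero[OF *] by simp
  qed
  then show ?thesis using c(2)[OF v] by simp
qed

section \<open>Recovering the boundary curve\<close>

text \<open>An abstract form of the edges on one line: \<open>S\<close> stands for their endpoints,
  \<open>h\<close> for the position on the line, and \<open>R\<close> relates the two ends of an
  edge.\<close>

locale gap_free_pairing =
  fixes h :: "'a \<Rightarrow> real" and S :: "'a set" and R :: "'a \<Rightarrow> 'a \<Rightarrow> bool"
  assumes fin: "finite S" and inj: "inj_on h S"
    and closed: "R u w \<Longrightarrow> u \<in> S \<Longrightarrow> w \<in> S"
    and sym: "R u w \<Longrightarrow> R w u"
    and total: "u \<in> S \<Longrightarrow> \<exists>w. R u w"
    and unique: "R u w \<Longrightarrow> R u w' \<Longrightarrow> w = w'"
    and irrefl: "R u w \<Longrightarrow> u \<noteq> w"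
    and no_gap: "R u w \<Longrightarrow> u \<in> S \<Longrightarrow> x \<in> S \<Longrightarrow> h u < h x \<Longrightarrow> h x < h w \<Longrightarrow> False"

text \<open>Consider the lowest point \<open>v\<close> at which the pairings differ. Its two
  partners \<open>x\<close> and \<open>y\<close> both lie above it, since a lower one would be
  matched to \<open>v\<close> by both pairings. Then the nearer partner lies in the gap between
  \<open>v\<close> and the farther one.\<close>

lemma gap_free_pairing_unique:
  assumes "gap_free_pairing h S R" "gap_free_pairing h S R'"
    and uw: "R u w" "u \<in> S"
  shows "R' u w"
proof (rule ccontr)
  interpret R: gap_free_pairing h S R by fact
  interpret R': gap_free_pairing h S R' by fact
  assume not: "\<not> R' u w"
  define B where "B = {u \<in> S. \<exists>w. R u w \<and> \<not> R' u w}"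
  have B: "finite B" "u \<in> B" using R.fin uw not by (auto simp: B_def)
  then obtain v where v: "v \<in> B" "\<And>x. x \<in> B \<Longrightarrow> h v \<le> h x"
    using arg_min_if_finite(1)[of B h] arg_min_least[of B _ h] by blast
  then obtain x where x: "v \<in> S" "R v x" "\<not> R' v x" by (auto simp: B_def)
  obtain y where y: "R' v y" using R'.total x(1) by blast
  have S: "x \<in> S" "y \<in> S" using R.closed R'.closed x y by blast+
  have ne: "x \<noteq> y" "v \<noteq> x" "v \<noteq> y" using x y R.irrefl R'.irrefl by blast+
  have "h v < h x"
  proof (rule ccontr)
    assume "\<not> h v < h x"
    then have "h x < h v" using inj_onD[OF R.inj, of v x] ne S x(1) by fastforce
    then have "x \<notin> B" using v(2) by fastforce
    then have "R' x v" using S R.sym[OF x(2)] by (auto simp: B_def)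
    then show False using x(3) R'.sym by blast
  qed
  moreover have "h v < h y"
  proof (rule ccontr)
    assume "\<not> h v < h y"
    then have "h y < h v" using inj_onD[OF R.inj, of v y] ne S x(1) by fastforce
    then have "y \<notin> B" using v(2) by fastforce
    moreover obtain z where z: "R y z" using R.total S by blast
    ultimately have "R' y z" using S by (auto simp: B_def)
    then have "z = v" using R'.unique R'.sym[OF y] by blast
    then show False using z R.sym R.unique x(2) ne by blast
  qed
  moreover have "h x \<noteq> h y" using inj_onD[OF R.inj] ne S by blast
  ultimately show False
    using R.no_gap[OF x(2,1) S(2)] R'.no_gap[OF y x(1) S(1)] by linarith
qed

section \<open>Vertices and their edge directions\<close>

context directed_polygon
begin

text \<open>The sum has at most one term and is zero away from the vertices, so two polygons can be
  compared over the union of their vertex sets.\<close>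

definition point_weight :: "point \<Rightarrow> point \<Rightarrow> real" where
  "point_weight v t = (\<Sum>j | j < n \<and> vertex vs (Suc j) = v. vertex_weight t j)"

lemma point_weight_outside: "v \<notin> set vs \<Longrightarrow> point_weight v t = 0"
  using vertex_in_set[OF vs_nonempty] by (auto simp: point_weight_def intro!: sum.neutral)

lemma sum_vertex_weights:
  assumes "finite V" "set vs \<subseteq> V"
  shows "(\<Sum>j<n. of_real (vertex_weight t j) * plane_wave t (vertex vs (Suc j)))
       = (\<Sum>v\<in>V. of_real (point_weight v t) * plane_wave t v)"
proof -
  have "(\<Sum>v\<in>V. of_real (point_weight v t) * plane_wave t v)
     = (\<Sum>v\<in>V. \<Sum>j | j \<in> {..<n} \<and> vertex vs (Suc j) = v. of_real (vertex_weight t j) * plane_wave t (vertex vs (Suc j)))"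
    unfolding point_weight_def of_real_sum sum_distrib_right by (intro sum.cong) auto
  also have "\<dots> = (\<Sum>j<n. of_real (vertex_weight t j) * plane_wave t (vertex vs (Suc j)))"
    using assms vertex_in_set[OF vs_nonempty] by (intro sum.group) auto
  finally show ?thesis by simp
qed

text \<open>The nodes are complex, so the weight is extended to complex arguments. Two adjacent
  edges have different directions, which leaves a product of \<open>k - 2\<close> linear
  forms.\<close>

lemma bipoly_point_weight:
  "\<exists>F :: complex \<Rightarrow> complex \<Rightarrow> complex. bipoly (k - 2) F \<and>
     (\<forall>x y. F (of_real x) (of_real y) = of_real (point_weight v (x, y)))"
proof -
  define F :: "nat \<Rightarrow> complex \<Rightarrow> complex \<Rightarrow> complex" where
    "F = (\<lambda>j x y. of_real (det2 (s (dir j)) (s (dir (Suc j)))) *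
       (\<Prod>i\<in>{1..k} - {dir j, dir (Suc j)}. of_real (fst (s i)) * x + of_real (snd (s i)) * y))"
  have "bipoly (k - 2) (F j)" for j
  proof -
    have "card ({1..k} - {dir j, dir (Suc j)}) = k - 2"
      using dir(1)[of j] dir(1)[of "Suc j"] dir_Suc_neq[of j] by (subst card_Diff_subset) auto
    then show ?thesis
      unfolding F_def
      using bipoly_scale[OF bipoly_prod[of "{1..k} - {dir j, dir (Suc j)}"
        "\<lambda>i. complex_of_real (fst (s i))" "\<lambda>i. complex_of_real (snd (s i))"]] by simp
  qed
  then have "bipoly (k - 2) (\<lambda>x y. \<Sum>j | j < n \<and> vertex vs (Suc j) = v. F j x y)"
    by (rule bipoly_sum)
  moreover have "s i \<bullet> (x, y) = fst (s i) * x + snd (s i) * y" for i x y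
    by (cases "s i") simp
  then have "F j (of_real x) (of_real y) = of_real (vertex_weight (x, y) j)" for j x y
    by (simp add: F_def vertex_weight_def)
  then have "(\<Sum>j | j < n \<and> vertex vs (Suc j) = v. F j (of_real x) (of_real y)) = of_real (point_weight v (x, y))" for x y
    by (simp add: point_weight_def)
  ultimately show ?thesis by blast
qed

lemma vertex_Suc_eq_iff: "vertex vs (Suc i) = vertex vs (Suc j) \<longleftrightarrow> i mod n = j mod n"
  using n_ge_3 by (auto simp: vertex_eq_iff[OF distinct_vs vs_nonempty] mod_Suc split: if_splits)

lemma vertex_cases:
  assumes "v \<in> set vs"
  obtains a where "v = vertex vs (Suc a)"
proof -
  obtain i where "i < n" "v = vs ! i" using assms by (metis in_set_conv_nth)
  then have "v = vertex vs (Suc (i + n - 1))"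
    by (simp add: vertex_def Suc_diff_Suc flip: Suc_diff_le)
  then show ?thesis using that by blast
qed

lemma dir_mod [simp]: "dir (j mod n) = dir j" "dir (Suc (j mod n)) = dir (Suc j)"
  by (rule dir_cong; simp)+

lemma point_weight_vertex: "point_weight (vertex vs (Suc a)) t = vertex_weight t a"
proof -
  have "a mod n < n" using n_ge_3 by (intro mod_less_divisor) linarith
  then have "{j. j < n \<and> vertex vs (Suc j) = vertex vs (Suc a)} = {a mod n}"
    by (auto simp: vertex_Suc_eq_iff)
  then show ?thesis by (simp add: point_weight_def vertex_weight_def)
qed

text \<open>The weight of a vertex is a multiple of a product of linear forms, one for each direction not
  taken by the two edges at the vertex, so its zeros reveal the directions of these edges.\<close>

definition has_dir :: "nat \<Rightarrow> point \<Rightarrow> bool" where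
  "has_dir d v \<longleftrightarrow> d \<in> {1..k} \<and> point_weight v (- snd (s d), fst (s d)) \<noteq> 0"

text \<open>For \<open>t\<close> orthogonal to \<open>s d\<close>, the form of \<open>s i\<close>
  becomes the determinant of \<open>s d\<close> and \<open>s i\<close> and vanishes only for
  \<open>i = d\<close>. The weight is thus nonzero exactly when the form of \<open>d\<close> is
  missing from the product.\<close>

lemma has_dir_vertex: "has_dir d (vertex vs (Suc a)) \<longleftrightarrow> d \<in> {dir a, dir (Suc a)}"
proof (cases "d \<in> {1..k}")
  case True
  have inner: "s i \<bullet> (- snd (s d), fst (s d)) = det2 (s d) (s i)" for i
    by (cases "s i") (simp add: det2_def mult.commute)
  have "det2 (s (dir a)) (s (dir (Suc a))) \<noteq> 0"
    using not_parallel dir(1) dir_Suc_neq by blast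
  moreover have "det2 (s d) (s i) = 0 \<longleftrightarrow> i = d" if "i \<in> {1..k}" for i
    using not_parallel[OF True that] by (auto simp: det2_def)
  ultimately show ?thesis
    using True by (auto simp: has_dir_def point_weight_vertex vertex_weight_def inner)
next
  case False
  then show ?thesis using dir(1)[of a] dir(1)[of "Suc a"] by (auto simp: has_dir_def)
qed

lemma has_dir_imp_vertex: "has_dir d v \<Longrightarrow> v \<in> set vs"
  by (metis has_dir_def point_weight_outside)

definition partner :: "nat \<Rightarrow> point \<Rightarrow> point \<Rightarrow> bool" where
  "partner d u w \<longleftrightarrow> (\<exists>j. dir j = d \<and>
     (u = vertex vs j \<and> w = vertex vs (Suc j) \<or> w = vertex vs j \<and> u = vertex vs (Suc j)))"

lemma partner_sym: "partner d u w \<Longrightarrow> partner d w u"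
  by (auto simp: partner_def)

lemma partner_vertex:
  "partner d (vertex vs (Suc a)) w \<longleftrightarrow>
     dir a = d \<and> w = vertex vs a \<or> dir (Suc a) = d \<and> w = vertex vs (Suc (Suc a))"
proof
  assume "partner d (vertex vs (Suc a)) w"
  then consider j where "dir j = d" "vertex vs (Suc a) = vertex vs j" "w = vertex vs (Suc j)"
    | j where "dir j = d" "w = vertex vs j" "vertex vs (Suc a) = vertex vs (Suc j)"
    by (auto simp: partner_def)
  then show "dir a = d \<and> w = vertex vs a \<or> dir (Suc a) = d \<and> w = vertex vs (Suc (Suc a))"
  proof cases
    case 1
    then have "j mod n = Suc a mod n"
      by (simp add: vertex_eq_iff[OF distinct_vs vs_nonempty])
    then have "dir j = dir (Suc a)" "vertex vs (Suc j) = vertex vs (Suc (Suc a))"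
      using dir_mod(1) vertex_Suc_eq_iff by metis+
    then show ?thesis using 1 by simp
  next
    case 2
    then have "j mod n = a mod n" by (simp add: vertex_Suc_eq_iff)
    then have "dir j = dir a" "vertex vs j = vertex vs a"
      using dir_mod(1) vertex_mod by metis+
    then show ?thesis using 2 by simp
  qed
qed (auto simp: partner_def)

lemma partner_imp_vertex: "partner d u w \<Longrightarrow> u \<in> set vs"
  using vertex_in_set[OF vs_nonempty] by (auto simp: partner_def)

lemma partner_imp_has_dir: "partner d u w \<Longrightarrow> has_dir d u"
  by (metis partner_imp_vertex vertex_cases partner_vertex has_dir_vertex insertI1 insertI2)

lemma has_dir_imp_partner: "has_dir d u \<Longrightarrow> \<exists>w. partner d u w"
  by (metis has_dir_imp_vertex vertex_cases partner_vertex has_dir_vertex insertE singletonD)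

lemma partner_unique: "partner d u w \<Longrightarrow> partner d u w' \<Longrightarrow> w = w'"
  by (metis partner_imp_vertex vertex_cases partner_vertex dir_Suc_neq)

lemma partner_multiple:
  assumes "partner d u w"
  obtains c where "c \<noteq> 0" "w = u + c *\<^sub>R s d"
proof -
  obtain j where j: "dir j = d" "u = vertex vs j \<and> w = vertex vs (Suc j) \<or> w = vertex vs j \<and> u = vertex vs (Suc j)"
    using assms by (auto simp: partner_def)
  obtain c where c: "c \<noteq> 0" "vertex vs (Suc j) - vertex vs j = c *\<^sub>R s d"
    using edge_vector_multiple[of j] j(1) by (auto simp: edge_vector_def)
  show ?thesis
    using that[of c] that[of "- c"] c j(2) by (auto simp: algebra_simps)
qed

lemma partner_edge:
  assumes "partner d u w"
  obtains j where "j < n" "dir j = d" "edge vs j = closed_segment u w" "{vertex vs j, vertex vs (Suc j)} = {u, w}"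
proof -
  obtain j where j: "dir j = d" "u = vertex vs j \<and> w = vertex vs (Suc j) \<or> w = vertex vs j \<and> u = vertex vs (Suc j)"
    using assms by (auto simp: partner_def)
  have "vertex vs (Suc (j mod n)) = vertex vs (Suc j)" by (simp add: vertex_Suc_eq_iff)
  moreover have "j mod n < n" using n_ge_3 by (intro mod_less_divisor) linarith
  ultimately show ?thesis
    using that[of "j mod n"] j by (auto simp: edge_def closed_segment_commute)
qed

text \<open>The edge of direction \<open>d\<close> at \<open>x\<close> and the edge from
  \<open>u\<close> to \<open>w\<close> either coincide or meet only in common endpoints, by
  simplicity of the polygon.\<close>

lemma partner_between:
  assumes "partner d u w" "has_dir d x" "x \<in> closed_segment u w"
  shows "x = u \<or> x = w"
proof -
  obtain i where i: "i < n" "edge vs i = closed_segment u w" "{vertex vs i, vertex vs (Suc i)} = {u, w}"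
    using partner_edge[OF assms(1)] .
  obtain y where "partner d x y" using has_dir_imp_partner[OF assms(2)] by blast
  then obtain j where j: "j < n" "edge vs j = closed_segment x y" "{vertex vs j, vertex vs (Suc j)} = {x, y}"
    using partner_edge by blast
  have x: "x \<in> edge vs i \<inter> edge vs j" using assms(3) i j by auto
  show ?thesis
  proof (cases "i = j")
    case True
    then show ?thesis using i(3) j(3) by blast
  next
    case False
    then have "edge vs i \<inter> edge vs j = {vertex vs i, vertex vs (Suc i)} \<inter> {vertex vs j, vertex vs (Suc j)}"
      using simple i(1) j(1) unfolding simple_polygon_def by blast
    then show ?thesis using x i(3) by blast
  qed
qed

definition dir_line :: "nat \<Rightarrow> point \<Rightarrow> point set" where
  "dir_line d v = {x. has_dir d x \<and> (\<exists>c. x = v + c *\<^sub>R s d)}"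

text \<open>The inner product with \<open>s d\<close> measures the position on a line of direction
  \<open>s d\<close>; a point in a gap would lie inside an edge.\<close>

lemma gap_free_pairing_partner:
  assumes d: "d \<in> {1..k}"
  shows "gap_free_pairing (\<lambda>x. x \<bullet> s d) (dir_line d v) (partner d)"
proof
  have pos: "s d \<bullet> s d > 0" using direction_nz[OF d] by simp
  show "finite (dir_line d v)"
    by (rule finite_subset[OF _ finite_set[of vs]]) (auto simp: dir_line_def has_dir_imp_vertex)
  show "inj_on (\<lambda>x. x \<bullet> s d) (dir_line d v)"
  proof (rule inj_onI)
    fix x y assume "x \<in> dir_line d v" "y \<in> dir_line d v" and eq: "x \<bullet> s d = y \<bullet> s d"
    then obtain a b where "x = v + a *\<^sub>R s d" "y = v + b *\<^sub>R s d" by (auto simp: dir_line_def)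
    then show "x = y" using eq pos by (simp add: inner_add_left)
  qed
  fix u w
  show "w \<in> dir_line d v" if p: "partner d u w" and u: "u \<in> dir_line d v"
  proof -
    obtain c where c: "w = u + c *\<^sub>R s d" using partner_multiple[OF p] by blast
    moreover obtain c' where "u = v + c' *\<^sub>R s d" using u by (auto simp: dir_line_def)
    ultimately have "w = v + (c' + c) *\<^sub>R s d" by (simp add: scaleR_add_left)
    then show ?thesis
      using partner_imp_has_dir[OF partner_sym[OF p]] by (auto simp: dir_line_def)
  qed
  show "u \<noteq> w" if p: "partner d u w"
  proof -
    obtain c where "c \<noteq> 0" "w = u + c *\<^sub>R s d" using partner_multiple[OF p] .
    then show ?thesis using direction_nz[OF d] by simp
  qed
  show "\<exists>w. partner d u w" if "u \<in> dir_line d v"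
    using that has_dir_imp_partner unfolding dir_line_def by blast
  fix x assume *: "partner d u w" "u \<in> dir_line d v" "x \<in> dir_line d v" "u \<bullet> s d < x \<bullet> s d" "x \<bullet> s d < w \<bullet> s d"
  obtain c where c: "w = u + c *\<^sub>R s d" using partner_multiple[OF *(1)] by blast
  obtain a b where "u = v + a *\<^sub>R s d" "x = v + b *\<^sub>R s d" using *(2,3) by (auto simp: dir_line_def)
  then have x: "x = u + (b - a) *\<^sub>R s d" by (simp add: algebra_simps)
  have lt: "0 < b - a" "b - a < c"
    using *(4,5) pos unfolding x c by (simp_all add: inner_add_left zero_less_mult_iff)
  \<comment> \<open>The parameter of \<open>x\<close> on the segment from \<open>u\<close> to
    \<open>w\<close>.\<close>
  define r where "r = (b - a) / c"
  have r: "0 \<le> r" "r \<le> 1" "b - a = r * c" using lt by (simp_all add: r_def)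
  have "x = (1 - r) *\<^sub>R u + r *\<^sub>R w"
    unfolding x c r(3) by (simp add: algebra_simps)
  then have "x \<in> closed_segment u w"
    unfolding in_segment using r by blast
  then have "x = u \<or> x = w" using partner_between *(1,3) by (auto simp: dir_line_def)
  then show False using *(4,5) by auto
qed (use partner_sym partner_unique in blast)+

end

text \<open>On the line through an edge of \<open>vs\<close> both polygons have the same points to
  be paired. The pairing is unique, so the edge is also an edge of \<open>ws\<close>.\<close>

lemma boundary_curve_subset:
  assumes "directed_polygon k s vs" "directed_polygon k s ws"
    and eq: "directed_polygon.has_dir k s vs = directed_polygon.has_dir k s ws"
  shows "boundary_curve vs \<subseteq> boundary_curve ws"
proof -
  interpret P: directed_polygon k s vs by fact
  interpret Q: directed_polygon k s ws by fact
  have "edge vs j \<subseteq> boundary_curve ws" for j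
  proof -
    define d where "d = P.dir j"
    have d: "d \<in> {1..k}" unfolding d_def by (rule P.dir(1))
    let ?u = "vertex vs j" and ?w = "vertex vs (Suc j)"
    have pw: "P.partner d ?u ?w" by (auto simp: P.partner_def d_def)
    have line: "P.dir_line d ?u = Q.dir_line d ?u"
      by (simp add: P.dir_line_def Q.dir_line_def eq)
    have "?u \<in> P.dir_line d ?u"
      using P.partner_imp_has_dir[OF pw] by (auto simp: P.dir_line_def intro: exI[of _ 0])
    then have "Q.partner d ?u ?w"
      using gap_free_pairing_unique[OF P.gap_free_pairing_partner[OF d, of ?u] _ pw]
        Q.gap_free_pairing_partner[OF d, of ?u] line by simp
    then obtain i where "i < length ws" "edge ws i = closed_segment ?u ?w"
      using Q.partner_edge by blast
    moreover have "edge vs j = closed_segment ?u ?w" by (simp add: edge_def)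
    ultimately show ?thesis unfolding boundary_curve_def by blast
  qed
  then show ?thesis unfolding boundary_curve_def[of vs] by blast
qed

section \<open>Nodes and sampling points\<close>

lemma plane_wave_power: "plane_wave (of_nat m, of_nat n) v = plane_wave (1, 0) v ^ m * plane_wave (0, 1) v ^ n"
  by (cases v) (simp add: plane_wave_def exp_of_nat_mult[symmetric] exp_add[symmetric] algebra_simps)

lemma exp_frequency_inj:
  assumes "exp (- (2 * of_real pi * \<i> * of_real x)) = exp (- (2 * of_real pi * \<i> * complex_of_real y))"
    and "0 \<le> x" "x < 1" "0 \<le> y" "y < 1"
  shows "x = y"
proof -
  obtain l :: int where "- (2 * of_real pi * \<i> * of_real x) = - (2 * of_real pi * \<i> * complex_of_real y) + of_real (of_int (2 * l) * pi) * \<i>"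
    using assms(1) unfolding exp_eq by blast
  then have "2 * of_real pi * \<i> * (complex_of_real (y - x) - of_int l) = 0"
    by (simp add: algebra_simps)
  then have "complex_of_real (y - x) = of_real (of_int l)" by simp
  then have l: "y - x = of_int l" by (simp only: of_real_eq_iff)
  then have "\<bar>real_of_int l\<bar> < 1" using assms(2-5) by linarith
  then have "l = 0" by linarith
  then show ?thesis using l by simp
qed

text \<open>The half-open unit square contains at most one point of each class modulo the integer
  lattice, so different vertices give different nodes.\<close>

lemma plane_wave_node_inj:
  "inj_on (\<lambda>v. (plane_wave (1, 0) v, plane_wave (0, 1) v)) unit_square"
  by (auto simp: inj_on_def unit_square_def plane_wave_def dest!: exp_frequency_inj)

text \<open>The union of two vertex sets may have \<open>2 * N\<close> points, so \<open>r\<close>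
  runs up to \<open>2 * N\<close>, while the sampling set stops at \<open>N\<close>. For
  \<open>r > N\<close> the first range has length \<open>k - 1\<close>, and the rectangle of index
  \<open>N\<close> is large enough thanks to the factor \<open>2\<close> in its height.\<close>

lemma sampling_set_mem:
  assumes "k \<ge> 2" "1 \<le> r" "r \<le> 2 * N" "m < (2 * N) div r * (k - 1)" "n < r * (k - 1)"
  shows "(int m, int n) \<in> sampling_set k N"
proof -
  have k: "int k - 1 = int (k - 1)" using assms by simp
  have fl: "\<lfloor>2 * real N / real l\<rfloor> = int ((2 * N) div l)" for l
    using floor_divide_of_nat_eq[of "2 * N" l] by simp
  show ?thesis
  proof (cases "r \<le> N")
    case True
    have "m \<le> 2 * ((2 * N) div r) * (k - 1)" "n \<le> 2 * r * (k - 1)"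
      using assms(4,5) by simp_all
    then have "int m \<le> 2 * int ((2 * N) div r) * int (k - 1)" "int n \<le> 2 * int r * int (k - 1)"
      by (metis of_nat_le_iff of_nat_mult of_nat_numeral)+
    then show ?thesis
      unfolding sampling_set_def fl k using True assms(2) by auto
  next
    case False
    then have "(2 * N) div r = 1" "(2 * N) div N = 2"
      using assms(2,3) by (auto intro: div_nat_eqI)
    then have "m \<le> 2 * ((2 * N) div N) * (k - 1)"
      using assms(4) by simp
    moreover have "n \<le> 2 * N * (k - 1)"
      using order_trans[OF less_imp_le[OF assms(5)] mult_le_mono1[OF assms(3)]] .
    ultimately have "int m \<le> 2 * int ((2 * N) div N) * int (k - 1)" "int n \<le> 2 * int N * int (k - 1)"
      by (metis of_nat_le_iff of_nat_mult of_nat_numeral)+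
    then show ?thesis
      unfolding sampling_set_def fl k using False assms(2,3)
      by (intro UN_I[of N]) auto
  qed
qed

text \<open>The difference of the two Fourier formulas is an exponential polynomial on the union of
  the vertex sets. It vanishes on the sampling set, hence identically, which makes the weights of
  the two polygons proportional.\<close>

lemma has_dir_determined:
  assumes "directed_polygon k s vs" "directed_polygon k s ws"
    and N: "length vs \<le> N" "length ws \<le> N" and k: "k \<ge> 2"
    and eq: "\<And>a. a \<in> sampling_set k N \<Longrightarrow>
      fourier (indicator (polygonal_region vs)) (frequency a) = fourier (indicator (polygonal_region ws)) (frequency a)"
  shows "directed_polygon.has_dir k s vs = directed_polygon.has_dir k s ws"
proof -
  interpret P: directed_polygon k s vs by fact
  interpret Q: directed_polygon k s ws by fact
  define V where "V = set vs \<union> set ws"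
  have V: "finite V" "set vs \<subseteq> V" "set ws \<subseteq> V" "V \<subseteq> unit_square"
    using P.vertices_sub Q.vertices_sub by (auto simp: V_def)
  have cV: "card V \<le> 2 * N"
    using card_Un_le[of "set vs" "set ws"] card_length[of vs] card_length[of ws] N unfolding V_def by linarith
  obtain \<epsilon> where \<epsilon>: "\<epsilon> \<noteq> 0" "\<And>t. of_real (\<Prod>i\<in>{1..k}. s i \<bullet> t) * fourier (indicator (polygonal_region vs)) t
        = \<epsilon> * (\<Sum>j<P.n. of_real (P.vertex_weight t j) * plane_wave t (vertex vs (Suc j)))"
    using P.fourier_polygon by blast
  obtain \<delta> where \<delta>: "\<delta> \<noteq> 0" "\<And>t. of_real (\<Prod>i\<in>{1..k}. s i \<bullet> t) * fourier (indicator (polygonal_region ws)) t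
        = \<delta> * (\<Sum>j<Q.n. of_real (Q.vertex_weight t j) * plane_wave t (vertex ws (Suc j)))"
    using Q.fourier_polygon by blast
  have "\<exists>F :: complex \<Rightarrow> complex \<Rightarrow> complex. bipoly (k - 2) F \<and>
     (\<forall>x y. F (of_real x) (of_real y) = \<epsilon> * of_real (P.point_weight v (x, y)) - \<delta> * of_real (Q.point_weight v (x, y)))" for v
  proof -
    obtain F G :: "complex \<Rightarrow> complex \<Rightarrow> complex" where "bipoly (k - 2) F" "bipoly (k - 2) G"
      "\<And>x y. F (of_real x) (of_real y) = of_real (P.point_weight v (x, y))"
      "\<And>x y. G (of_real x) (of_real y) = of_real (Q.point_weight v (x, y))"
      using P.bipoly_point_weight[of v] Q.bipoly_point_weight[of v] by blast
    then show ?thesis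
      by (intro exI[of _ "\<lambda>x y. \<epsilon> * F x y + (- \<delta>) * G x y"] conjI bipoly_add bipoly_scale) auto
  qed
  then obtain F :: "point \<Rightarrow> complex \<Rightarrow> complex \<Rightarrow> complex" where F: "\<And>v. bipoly (k - 2) (F v)"
    "\<And>v x y. F v (of_real x) (of_real y) = \<epsilon> * of_real (P.point_weight v (x, y)) - \<delta> * of_real (Q.point_weight v (x, y))"
    by metis
  define node where "node = (\<lambda>v. (plane_wave (1, 0) v, plane_wave (0, 1) v))"
  have inj: "inj_on node V"
    unfolding node_def by (rule inj_on_subset[OF plane_wave_node_inj V(4)])
  have F0: "F v (of_real x) (of_real y) = 0" if v: "v \<in> V" for v x y
  proof -
    \<comment> \<open>The vanishing lemma indexes the coefficients by nodes; the inverse of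
      \<open>node\<close> leads back to the vertices.\<close>
    have "F (the_inv_into V node (node v)) (of_real x) (of_real y) = 0"
    proof (rule exponential_bipoly_eq_0[where V = "node ` V" and F = "\<lambda>z. F (the_inv_into V node z)"])
      show "finite (node ` V)" using V(1) by simp
      show "fst z \<noteq> 0 \<and> snd z \<noteq> 0" if "z \<in> node ` V" for z
        using that by (auto simp: node_def plane_wave_def)
      show "bipoly (k - 2) (F (the_inv_into V node z))" for z by (rule F(1))
      show "node v \<in> node ` V" using v by simp
      fix r m n assume r: "1 \<le> r" "r \<le> card (node ` V)"
        and m: "m < card (node ` V) div r * Suc (k - 2)" and n: "n < r * Suc (k - 2)"
      have k1: "Suc (k - 2) = k - 1" using k by simp
      have cn: "card (node ` V) = card V" by (rule card_image[OF inj])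
      have "card V div r * (k - 1) \<le> 2 * N div r * (k - 1)"
        using div_le_mono[OF cV] by (rule mult_le_mono1)
      then have mem: "(int m, int n) \<in> sampling_set k N"
        using r(2) m n cV unfolding k1 cn
        by (intro sampling_set_mem[OF k r(1)]) (blast intro: order_trans less_le_trans)+
      let ?t = "(real m, real n)"
      have freq: "frequency (int m, int n) = ?t" by (simp add: frequency_def)
      have "(\<Sum>z\<in>node ` V. F (the_inv_into V node z) (of_nat m) (of_nat n) * fst z ^ m * snd z ^ n)
         = (\<Sum>u\<in>V. F u (of_nat m) (of_nat n) * fst (node u) ^ m * snd (node u) ^ n)"
        by (subst sum.reindex[OF inj]) (simp add: the_inv_into_f_f[OF inj])
      also have "\<dots> = (\<Sum>u\<in>V. (\<epsilon> * of_real (P.point_weight u ?t) - \<delta> * of_real (Q.point_weight u ?t)) * plane_wave ?t u)"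
        using F(2)[of _ "real m" "real n"] by (simp add: plane_wave_power node_def mult.assoc)
      also have "\<dots> = \<epsilon> * (\<Sum>u\<in>V. of_real (P.point_weight u ?t) * plane_wave ?t u)
                    - \<delta> * (\<Sum>u\<in>V. of_real (Q.point_weight u ?t) * plane_wave ?t u)"
        by (simp add: sum_distrib_left left_diff_distrib sum_subtractf mult.assoc)
      also have "\<dots> = of_real (\<Prod>i\<in>{1..k}. s i \<bullet> ?t) * (fourier (indicator (polygonal_region vs)) ?t
           - fourier (indicator (polygonal_region ws)) ?t)"
        unfolding P.sum_vertex_weights[OF V(1,2), symmetric] Q.sum_vertex_weights[OF V(1,3), symmetric]
          right_diff_distrib \<epsilon>(2) \<delta>(2) ..
      also have "\<dots> = 0" using eq[OF mem] by (simp add: freq)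
      finally show "(\<Sum>z\<in>node ` V. F (the_inv_into V node z) (of_nat m) (of_nat n) * fst z ^ m * snd z ^ n) = 0" .
    qed
    then show ?thesis by (simp add: the_inv_into_f_f[OF inj v])
  qed
  \<comment> \<open>The constants \<epsilon> and \<delta> are unknown but nonzero, so the zeros of
    the weights can be compared although their values cannot.\<close>
  have "P.point_weight v t \<noteq> 0 \<longleftrightarrow> Q.point_weight v t \<noteq> 0" for v t
  proof (cases "v \<in> V")
    case True
    obtain x y where t: "t = (x, y)" by (cases t)
    have "\<epsilon> * of_real (P.point_weight v t) = \<delta> * of_real (Q.point_weight v t)"
      using F0[OF True, of x y] F(2)[of v x y] t by simp
    then show ?thesis using \<epsilon>(1) \<delta>(1) by (metis mult_eq_0_iff of_real_eq_0_iff)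
  next
    case False
    then show ?thesis using P.point_weight_outside Q.point_weight_outside V by (metis subsetD)
  qed
  then show ?thesis by (intro ext) (simp add: P.has_dir_def Q.has_dir_def)
qed

lemma polygonal_region_determined:
  assumes "directed_polygon k s vs" "directed_polygon k s ws"
    and "length vs \<le> N" "length ws \<le> N" "k \<ge> 2"
    and "\<And>a. a \<in> sampling_set k N \<Longrightarrow>
      fourier (indicator (polygonal_region vs)) (frequency a) = fourier (indicator (polygonal_region ws)) (frequency a)"
  shows "polygonal_region vs = polygonal_region ws"
proof -
  have "directed_polygon.has_dir k s vs = directed_polygon.has_dir k s ws"
    using assms by (rule has_dir_determined)
  then have "boundary_curve vs = boundary_curve ws"
    using boundary_curve_subset assms(1,2) by (metis subset_antisym)
  then show ?thesis by (simp add: polygonal_region_def)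
qed

section \<open>The size of the sampling set\<close>

text \<open>The difference of harmonic number and logarithm decreases from its value
  \<open>1\<close> at \<open>N = 1\<close>.\<close>

lemma harm_le_one_plus_ln:
  assumes "N \<ge> 1" shows "harm N \<le> 1 + ln (real N)"
proof -
  have "harm (Suc (N - 1)) - ln (real (Suc (N - 1))) \<le> harm (Suc 0) - ln (real (Suc 0))"
    using decseq_harm_diff_ln by (rule decseqD) simp
  then show ?thesis using assms by (simp add: harm_def)
qed

text \<open>The set is a hyperbolic cross: the rows with indices in \<open>[2(r - 1)(k - 1), 2r(k - 1)]\<close> only
  contain entries with first coordinate at most \<open>4N(k - 1)/r\<close>.\<close>

lemma card_sampling_set:
  assumes k: "k \<ge> 2" and N: "N \<ge> 1"
  shows "real (card (sampling_set k N)) \<le> 10 * (real k)\<^sup>2 * real N * harm N"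
proof -
  define K where "K = int k - 1"
  have K: "K \<ge> 1" "real_of_int K = real k - 1" using k by (auto simp: K_def)
  define M where "M = (\<lambda>r::nat. \<lfloor>4 * real N * real_of_int K / real r\<rfloor>)"
  define B where "B = (\<lambda>r::nat. {0..M r} \<times> {2 * (int r - 1) * K..2 * int r * K})"
  have "sampling_set k N \<subseteq> (\<Union>r\<in>{1..N}. B r)"
  proof
    fix a assume "a \<in> sampling_set k N"
    then obtain m n r where a: "a = (m, n)" and r: "1 \<le> r" "r \<le> N" and m: "0 \<le> m" "m \<le> 2 * \<lfloor>2 * real N / real r\<rfloor> * K"
      and n: "0 \<le> n" "n \<le> 2 * int r * K"
      by (auto simp: sampling_set_def K_def)
    \<comment> \<open>The index of the strip containing \<open>n\<close>. Minimality gives the lower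
      end of the strip and \<open>q \<le> r\<close>, so that the bound on \<open>m\<close> only gets
      weaker when \<open>r\<close> is replaced by \<open>q\<close>.\<close>
    define q where "q = (LEAST q. 1 \<le> q \<and> n \<le> 2 * int q * K)"
    have q: "1 \<le> q" "n \<le> 2 * int q * K"
      using LeastI[of "\<lambda>q. 1 \<le> q \<and> n \<le> 2 * int q * K" r] r n unfolding q_def by blast+
    have qr: "q \<le> r"
      unfolding q_def using r n by (intro Least_le) auto
    have low: "2 * (int q - 1) * K \<le> n"
    proof (cases "q = 1")
      case False
      then have "q - 1 < q" using q by simp
      then have "\<not> (1 \<le> q - 1 \<and> n \<le> 2 * int (q - 1) * K)"
        unfolding q_def by (rule not_less_Least)
      moreover have "1 \<le> q - 1" "int (q - 1) = int q - 1" using False q(1) by auto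
      ultimately show ?thesis by simp
    qed (use n in simp)
    have "real_of_int m \<le> 2 * real_of_int \<lfloor>2 * real N / real r\<rfloor> * real_of_int K"
      using m(2) by (metis of_int_le_iff of_int_mult of_int_numeral)
    also have "\<dots> \<le> 2 * (2 * real N / real r) * real_of_int K"
      using K(1) by (intro mult_right_mono mult_left_mono of_int_floor_le) auto
    also have "\<dots> = 4 * real N * real_of_int K / real r" by simp
    also have "\<dots> \<le> 4 * real N * real_of_int K / real q"
      using qr q K(1) by (intro divide_left_mono) auto
    finally have "m \<le> M q" unfolding M_def by (simp add: le_floor_iff)
    then show "a \<in> (\<Union>r\<in>{1..N}. B r)"
      using a m n q qr r low by (auto simp: B_def intro!: bexI[of _ q])
  qed
  then have "card (sampling_set k N) \<le> card (\<Union>r\<in>{1..N}. B r)"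
    by (intro card_mono) (auto simp: B_def)
  also have "\<dots> \<le> (\<Sum>r\<in>{1..N}. card (B r))" by (rule card_UN_le) simp
  finally have "real (card (sampling_set k N)) \<le> (\<Sum>r\<in>{1..N}. real (card (B r)))"
    by (metis of_nat_le_iff of_nat_sum)
  also have "\<dots> \<le> (\<Sum>r\<in>{1..N}. 10 * (real k)\<^sup>2 * real N * inverse (real r))"
  proof (rule sum_mono)
    fix r assume "r \<in> {1..N}"
    then have r: "1 \<le> r" "r \<le> N" by auto
    have M0: "0 \<le> M r" using K(1) by (simp add: M_def)
    have "card (B r) = nat (M r + 1) * nat (2 * K + 1)"
      by (simp add: B_def card_cartesian_product algebra_simps)
    then have "real (card (B r)) = (real_of_int (M r) + 1) * (2 * real_of_int K + 1)"
      using M0 K(1) by simp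
    \<comment> \<open>The summand \<open>1\<close> is at most \<open>N * k / r\<close> because
      \<open>r \<le> N\<close>, and \<open>2 * K + 1 = 2 * k - 1\<close>; this gives the constant
      \<open>(4 + 1) * 2 = 10\<close>.\<close>
    also have "\<dots> \<le> (4 * real N * real k / real r + real N * real k / real r) * (2 * real k)"
    proof (intro mult_mono add_mono)
      have "real_of_int (M r) \<le> 4 * real N * real_of_int K / real r"
        unfolding M_def by (rule of_int_floor_le)
      also have "\<dots> \<le> 4 * real N * real k / real r"
        using K(2) by (intro divide_right_mono mult_left_mono) auto
      finally show "real_of_int (M r) \<le> 4 * real N * real k / real r" .
      have "real r * 1 \<le> real N * real k" using r k by (intro mult_mono) auto
      then show "1 \<le> real N * real k / real r" using r by (simp add: field_simps)
    qed (use K M0 in auto)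
    also have "\<dots> = 10 * (real k)\<^sup>2 * real N * inverse (real r)"
      by (simp add: power2_eq_square field_simps)
    finally show "real (card (B r)) \<le> 10 * (real k)\<^sup>2 * real N * inverse (real r)" .
  qed
  also have "\<dots> = 10 * (real k)\<^sup>2 * real N * harm N"
    by (simp add: harm_def sum_distrib_left)
  finally show ?thesis .
qed

lemma card_sampling_set_ln:
  assumes "k \<ge> 2" "N \<ge> 3"
  shows "real (card (sampling_set k N)) \<le> 20 * (real k)\<^sup>2 * real N * ln (real N)"
proof -
  \<comment> \<open>Since \<open>N \<ge> 3\<close> exceeds Euler's number, the additive
    \<open>1\<close> of the harmonic bound is absorbed and the constant doubles.\<close>
  have "1 \<le> ln (real N)"
    using assms exp_le by (subst ln_ge_iff) (auto intro: order_trans)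
  then have "harm N \<le> 2 * ln (real N)"
    using harm_le_one_plus_ln[of N] assms by simp
  then have "10 * (real k)\<^sup>2 * real N * harm N \<le> 10 * (real k)\<^sup>2 * real N * (2 * ln (real N))"
    by (intro mult_left_mono) auto
  moreover have "10 * (real k)\<^sup>2 * real N * (2 * ln (real N)) = 20 * (real k)\<^sup>2 * real N * ln (real N)"
    by simp
  ultimately show ?thesis using card_sampling_set[of k N] assms by linarith
qed

theorem theorem3p1:
  "(\<forall>(k::nat) (N::nat) (s :: nat \<Rightarrow> real \<times> real).
      k \<ge> 2 \<longrightarrow> N \<ge> 3 \<longrightarrow>
      (\<forall>i\<in>{1..k}. norm (s i) = 1) \<longrightarrow>
      (\<forall>i\<in>{1..k}. \<forall>j\<in>{1..k}. i \<noteq> j \<longrightarrow> \<not> parallel (s i) (s j)) \<longrightarrow>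
      (\<forall>P\<in>polygon_class k N s. \<forall>Q\<in>polygon_class k N s.
         (\<forall>a\<in>sampling_set k N.
            fourier (indicator P) (frequency a) = fourier (indicator Q) (frequency a)) \<longrightarrow>
         P = Q)) \<and>
   (\<exists>C::real. \<forall>(k::nat) (N::nat). k \<ge> 2 \<longrightarrow> N \<ge> 3 \<longrightarrow>
      real (card (sampling_set k N)) \<le> C * (real k)\<^sup>2 * real N * ln (real N))"
proof (intro conjI allI impI ballI)
  fix k N :: nat and s :: "nat \<Rightarrow> real \<times> real" and P Q
  assume k: "k \<ge> 2" and "N \<ge> 3" and unit: "\<forall>i\<in>{1..k}. norm (s i) = 1"
    and np: "\<forall>i\<in>{1..k}. \<forall>j\<in>{1..k}. i \<noteq> j \<longrightarrow> \<not> parallel (s i) (s j)"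
    and P: "P \<in> polygon_class k N s" and Q: "Q \<in> polygon_class k N s"
    and eq: "\<forall>a\<in>sampling_set k N. fourier (indicator P) (frequency a) = fourier (indicator Q) (frequency a)"
  have "\<exists>vs. directed_polygon k s vs \<and> length vs \<le> N \<and> P = polygonal_region vs"
    if "P \<in> polygon_class k N s" for P
  proof -
    have dirs: "directions k s"
    proof
      show "s i \<noteq> 0" if "i \<in> {1..k}" for i using unit that by (metis norm_zero zero_neq_one)
    qed (use np in \<open>auto simp: parallel_iff_det2\<close>)
    obtain vs where "P \<subseteq> unit_square" "simple_polygon vs" "length vs \<le> N" "set vs \<subseteq> unit_square"
      "\<forall>j<length vs. \<exists>i\<in>{1..k}. parallel (edge_vector vs j) (s i)" "P = polygonal_region vs"
      using \<open>P \<in> polygon_class k N s\<close> by (auto simp: polygon_class_def)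
    then show ?thesis
      using dirs by (intro exI[of _ vs]) (auto simp: directed_polygon_def directed_polygon_axioms_def)
  qed
  then obtain vs ws where "directed_polygon k s vs" "length vs \<le> N" "P = polygonal_region vs"
    "directed_polygon k s ws" "length ws \<le> N" "Q = polygonal_region ws"
    using P Q by blast
  then show "P = Q" using polygonal_region_determined[of k s vs ws N] k eq by blast
qed (use card_sampling_set_ln in blast)

end
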